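(* Let $\{\xi_{i,j}:(i,j)\in\mathbb{N}^2\}$ be an array of non-degenerate i.i.d. complex random variables satisfying $\mathbb{E}\left[(\log(1+|\xi_{0,0}|))^2\right]<\infty$, and for $n\ge1$ let $$K_n(z_1,z_2)=\sum_{0\le i+j\le n}\xi_{i,j}z_1^iz_2^j .$$ Let $Z_{K_n}=dd^c\left(\frac1n\log|K_n|\right)$ be the (normalized) zero set of $K_n$ viewed as a $(1,1)$ current on $\mathbb{C}^2$. Then $$\lim_{n\to\infty}Z_{K_n}=dd^cV\quad\text{almost surely (as currents)},$$ where $V(z,w)=\max(0,\log|z|,\log|w|)$.
   Context: $\mathbb{N}=\{0,1,2,\dots\}$. A random variable is non-degenerate if its law is supported on at least two points. $dd^c=\frac{i}{\pi}\partial\overline\partial$. Convergence of $(1,1)$ currents on $\mathbb{C}^2$ means convergence when paired with each smooth compactly supported $(1,1)$ test form. Almost surely $K_n\not\equiv0$ for all large $n$, so $Z_{K_n}$ is defined for all large $n$. *)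

theory Defs
  imports "HOL-Probability.Probability"
begin

section \<open>Smooth functions and differential forms on the complex plane squared\<close>

type_synonym C2 = "complex \<times> complex"

text \<open>Smoothness is over the reals: \<open>f\<close> is of class $C^{k+1}$ iff it is differentiable
  everywhere and all its directional derivatives are of class $C^k$.\<close>

fun Ck :: "nat \<Rightarrow> (C2 \<Rightarrow> complex) \<Rightarrow> bool" where
  "Ck 0 f \<longleftrightarrow> continuous_on UNIV f"
| "Ck (Suc k) f \<longleftrightarrow>
     (\<forall>z. f differentiable (at z)) \<and> (\<forall>v. Ck k (\<lambda>z. frechet_derivative f (at z) v))"

definition smooth :: "(C2 \<Rightarrow> complex) \<Rightarrow> bool" where
  "smooth f \<longleftrightarrow> (\<forall>k. Ck k f)"

datatype covec = Dz1 | Dzbar1 | Dz2 | Dzbar2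

text \<open>The Wirtinger derivative dual to a basis covector, e.g.
  $\partial/\partial z_1 = \frac12 (\partial/\partial x_1 - i\,\partial/\partial y_1)$.\<close>

fun wirtinger :: "covec \<Rightarrow> (C2 \<Rightarrow> complex) \<Rightarrow> C2 \<Rightarrow> complex" where
  "wirtinger Dz1 f z =
     (frechet_derivative f (at z) (1, 0) - \<i> * frechet_derivative f (at z) (\<i>, 0)) / 2"
| "wirtinger Dzbar1 f z =
     (frechet_derivative f (at z) (1, 0) + \<i> * frechet_derivative f (at z) (\<i>, 0)) / 2"
| "wirtinger Dz2 f z =
     (frechet_derivative f (at z) (0, 1) - \<i> * frechet_derivative f (at z) (0, \<i>)) / 2"
| "wirtinger Dzbar2 f z =
     (frechet_derivative f (at z) (0, 1) + \<i> * frechet_derivative f (at z) (0, \<i>)) / 2"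

text \<open>An exterior form at a point is given by its coefficients: a set \<open>S\<close> of covectors stands for
  the basis element obtained by wedging the members of \<open>S\<close> in the order
  $dz_1, d\bar z_1, dz_2, d\bar z_2$ recorded by \<open>rank\<close>.\<close>

type_synonym exterior = "covec set \<Rightarrow> complex"
type_synonym form = "C2 \<Rightarrow> exterior"

fun rank :: "covec \<Rightarrow> nat" where
  "rank Dz1 = 0" | "rank Dzbar1 = 1" | "rank Dz2 = 2" | "rank Dzbar2 = 3"

text \<open>Left multiplication \<open>g \<and> \<alpha>\<close>; the sign comes from moving \<open>g\<close> past the covectors
  of smaller rank.\<close>

definition wedge :: "covec \<Rightarrow> exterior \<Rightarrow> exterior" where
  "wedge g \<alpha> S =
     (if g \<in> S then (-1) ^ card {h \<in> S. rank h < rank g} * \<alpha> (S - {g}) else 0)"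

definition del :: "form \<Rightarrow> form" where
  "del \<phi> z S = (\<Sum>g\<in>{Dz1, Dz2}. wedge g (\<lambda>T. wirtinger g (\<lambda>w. \<phi> w T) z) S)"

definition delbar :: "form \<Rightarrow> form" where
  "delbar \<phi> z S = (\<Sum>g\<in>{Dzbar1, Dzbar2}. wedge g (\<lambda>T. wirtinger g (\<lambda>w. \<phi> w T) z) S)"

definition ddc :: "form \<Rightarrow> form" where
  "ddc \<phi> z S = \<i> / of_real pi * del (delbar \<phi>) z S"

text \<open>Integration of \<open>u\<close> times a form of top degree. The factor is $(-2i)^2$, since
  $dz \wedge d\bar z = -2i\, dx \wedge dy$; orientation as $dx_1\, dy_1\, dx_2\, dy_2$.\<close>

definition integral_form :: "(C2 \<Rightarrow> real) \<Rightarrow> form \<Rightarrow> complex" where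
  "integral_form u \<psi> =
     (LINT z|lborel. of_real (u z) * ((- 2 * \<i>)\<^sup>2 * \<psi> z {Dz1, Dzbar1, Dz2, Dzbar2}))"

section \<open>Currents of bidegree (1,1)\<close>

definition test_forms11 :: "form set" where
  "test_forms11 = {\<phi>.
     (\<forall>S. smooth (\<lambda>z. \<phi> z S)) \<and>
     (\<forall>z S. \<phi> z S \<noteq> 0 \<longrightarrow> card (S \<inter> {Dz1, Dz2}) = 1 \<and> card (S \<inter> {Dzbar1, Dzbar2}) = 1) \<and>
     compact (closure {z. \<exists>S. \<phi> z S \<noteq> 0})}"

type_synonym current11 = "form \<Rightarrow> complex"

text \<open>The current $dd^c u$ of a locally integrable function \<open>u\<close>:
  $\langle dd^c u, \phi\rangle = \int u\, dd^c \phi$.\<close>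

definition ddc_current :: "(C2 \<Rightarrow> real) \<Rightarrow> current11" where
  "ddc_current u \<phi> = integral_form u (ddc \<phi>)"

definition current_tendsto :: "(nat \<Rightarrow> current11) \<Rightarrow> current11 \<Rightarrow> bool" where
  "current_tendsto T T\<^sub>0 \<longleftrightarrow> (\<forall>\<phi>\<in>test_forms11. (\<lambda>n. T n \<phi>) \<longlonglongrightarrow> T\<^sub>0 \<phi>)"

section \<open>Random variables and random polynomials\<close>

definition law_support :: "'a measure \<Rightarrow> ('a \<Rightarrow> complex) \<Rightarrow> complex set" where
  "law_support M X = {x. \<forall>U. open U \<longrightarrow> x \<in> U \<longrightarrow> emeasure (distr M borel X) U > 0}"

definition nondegenerate :: "'a measure \<Rightarrow> ('a \<Rightarrow> complex) \<Rightarrow> bool" where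
  "nondegenerate M X \<longleftrightarrow> (\<exists>a b. a \<noteq> b \<and> a \<in> law_support M X \<and> b \<in> law_support M X)"

definition Kpoly :: "(nat \<times> nat \<Rightarrow> complex) \<Rightarrow> nat \<Rightarrow> C2 \<Rightarrow> complex" where
  "Kpoly c n = (\<lambda>(z\<^sub>1, z\<^sub>2). \<Sum>(i, j)\<in>{(i, j). i + j \<le> n}. c (i, j) * z\<^sub>1 ^ i * z\<^sub>2 ^ j)"

text \<open>In Isabelle \<open>ln 0 = 0\<close>. If \<open>Kpoly c n\<close> is not identically zero, its zero set is Lebesgue-null
  and the convention has no effect. If it is identically zero, \<open>Z_current c n\<close> is the zero current;
  this can only matter for finitely many \<open>n\<close> whenever the sequence has a nonzero limit.\<close>

definition Z_current :: "(nat \<times> nat \<Rightarrow> complex) \<Rightarrow> nat \<Rightarrow> current11" where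
  "Z_current c n = ddc_current (\<lambda>z. 1 / real n * ln (cmod (Kpoly c n z)))"

text \<open>Here \<open>ln 0 = 0\<close> is harmless, because of the maximum with 0.\<close>

definition V :: "C2 \<Rightarrow> real" where
  "V = (\<lambda>(z, w). max 0 (max (ln (cmod z)) (ln (cmod w))))"

end

theory Submission
  imports Defs "HOL-Computational_Algebra.Fundamental_Theorem_Algebra" "HOL-Real_Asymp.Real_Asymp"
begin

text \<open>
  Write $u_n = \frac1n \log|K_n|$. Since $dd^c$ is tested against continuous compactly supported
  densities, it suffices that almost surely $u_n \to V$ in $L^1_{loc}$.

  Upper bound: the second logarithmic moment and Borel--Cantelli give
  $|\xi_{i,j}| \le C e^{\epsilon(i+j)}$, so $u_n \le V + \epsilon$ everywhere for large $n$.

  Lower bound: at a generic point the monomials of degree at most $n$ contain a geometric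
  sequence of length of order $n$ starting at $e^{nV}$ and staying above $e^{n(V-\epsilon)}$.
  If consecutive coefficients of a random sum shrink fast enough, each new term multiplies the
  concentration function at the scale of that term by a fixed $q < 1$. Hence
  $P(|K_n| < e^{n(V-\epsilon)})$ decays exponentially, and Borel--Cantelli and Fubini give
  $u_n \to V$ almost everywhere, almost surely.

  Uniform integrability: if $p$ has degree at most $n$ and $p(z_0) \ne 0$, comparing root by root and
  using the inequality of arithmetic and geometric means bounds
  $\int_{|z| \le R} |p|^{-1/(2n)}$ by $C_R |p(z_0)|^{-1/(2n)}$. Applied in each
  variable this bounds $\int e^{-u_n/2}$, hence $u_n - V$ in $L^2_{loc}$.
\<close>

section \<open>Test forms\<close>

text \<open>The logarithm is not bounded below, so convergence almost everywhere does not by itself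
  give convergence of integrals. The negative moment supplies the missing control, and it needs only
  one point \<open>(z0, w0)\<close> at which |K_n| is not too small. The almost everywhere lower
  bound provides that point, so the same probabilistic estimate is used twice. The exponent -1/(2n)
  is scaled to the degree: the n-th root averages over n roots, and the remaining power |z -
  a|^(-1/2) is integrable on discs of the plane with a bound that does not depend on a.

  The laws may be discrete, so no density bounds a single term. Non-degeneracy only says that every
  ball of a fixed radius \<open>r0\<close> misses a fixed share of the mass, and this gain has to be
  repeated order n times. It can be repeated once the next coefficient is smaller by a factor of at
  most \<open>r0 / (r0 + B)\<close>, which is why a sparse geometric subfamily of the monomials is
  singled out. All other monomials, whatever their size, act as an independent shift, harmless
  because the bounds are uniform in the centre of the ball.\<close>

lemma Ck_const: "Ck k (\<lambda>z. c)"
  by (induction k arbitrary: c) auto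

lemma Ck_add:
  assumes "Ck k f" "Ck k g"
  shows "Ck k (\<lambda>z. f z + g z)"
  using assms
proof (induction k arbitrary: f g)
  case 0
  then show ?case by (auto intro: continuous_on_add)
next
  case (Suc k)
  have "frechet_derivative (\<lambda>z. f z + g z) (at z) =
      (\<lambda>v. frechet_derivative f (at z) v + frechet_derivative g (at z) v)" for z
    using Suc.prems[THEN iffD1[OF Ck.simps(2)]]
    by (intro frechet_derivative_at[symmetric] has_derivative_add)
       (simp_all only: frechet_derivative_works)
  then show ?case
    using Suc by auto
qed

lemma Ck_cmult:
  assumes "Ck k f"
  shows "Ck k (\<lambda>z. c * f z)"
  using assms
proof (induction k arbitrary: f)
  case 0
  then show ?case by (auto intro: continuous_intros)
next
  case (Suc k)
  have "frechet_derivative (\<lambda>z. c * f z) (at z) = (\<lambda>v. c * frechet_derivative f (at z) v)" for z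
    using Suc.prems[THEN iffD1[OF Ck.simps(2)]]
    by (intro frechet_derivative_at[symmetric] has_derivative_mult_right)
       (simp_all only: frechet_derivative_works)
  then show ?case
    using Suc by auto
qed

lemma smooth_const: "smooth (\<lambda>z. c)"
  by (simp add: smooth_def Ck_const)

lemma smooth_add: "smooth f \<Longrightarrow> smooth g \<Longrightarrow> smooth (\<lambda>z. f z + g z)"
  by (simp add: smooth_def Ck_add)

lemma smooth_cmult: "smooth f \<Longrightarrow> smooth (\<lambda>z. c * f z)"
  by (simp add: smooth_def Ck_cmult)

lemma smooth_sum: "(\<And>i. i \<in> I \<Longrightarrow> smooth (f i)) \<Longrightarrow> smooth (\<lambda>z. \<Sum>i\<in>I. f i z)"
  by (induction I rule: infinite_finite_induct) (auto intro: smooth_const smooth_add)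

lemma smooth_frechet_derivative: "smooth f \<Longrightarrow> smooth (\<lambda>z. frechet_derivative f (at z) v)"
  unfolding smooth_def using Ck.simps(2) by blast

lemma smooth_imp_continuous: "smooth f \<Longrightarrow> continuous_on UNIV f"
  unfolding smooth_def by (meson Ck.simps(1))

lemma smooth_wirtinger:
  assumes "smooth f"
  shows "smooth (wirtinger g f)"
proof -
  have *: "smooth (\<lambda>z. (1/2) * (frechet_derivative f (at z) u + c * frechet_derivative f (at z) v))"
    for u v c
    by (intro smooth_cmult smooth_add smooth_frechet_derivative assms)
  have "\<exists>u c v. wirtinger g f =
      (\<lambda>z. (1/2) * (frechet_derivative f (at z) u + c * frechet_derivative f (at z) v))"
  proof (cases g)
    case Dz1
    then show ?thesis by (intro exI[of _ "(1, 0)"] exI[of _ "- \<i>"] exI[of _ "(\<i>, 0)"]) auto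
  next
    case Dzbar1
    then show ?thesis by (intro exI[of _ "(1, 0)"] exI[of _ "\<i>"] exI[of _ "(\<i>, 0)"]) auto
  next
    case Dz2
    then show ?thesis by (intro exI[of _ "(0, 1)"] exI[of _ "- \<i>"] exI[of _ "(0, \<i>)"]) auto
  next
    case Dzbar2
    then show ?thesis by (intro exI[of _ "(0, 1)"] exI[of _ "\<i>"] exI[of _ "(0, \<i>)"]) auto
  qed
  then obtain u c v where "wirtinger g f =
      (\<lambda>z. (1/2) * (frechet_derivative f (at z) u + c * frechet_derivative f (at z) v))"
    by (elim exE)
  with *[of u c v] show ?thesis by (simp only:)
qed

lemma smooth_wedge:
  assumes "\<And>T. smooth (\<lambda>z. F z T)"
  shows "smooth (\<lambda>z. wedge g (F z) S)"
  unfolding wedge_def by (cases "g \<in> S") (auto intro: smooth_cmult smooth_const assms)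

lemma smooth_ddc:
  assumes "\<And>S. smooth (\<lambda>z. \<phi> z S)"
  shows "smooth (\<lambda>z. ddc \<phi> z S)"
  unfolding ddc_def del_def delbar_def
  by (intro smooth_cmult smooth_sum smooth_wedge smooth_wirtinger assms)

lemma wirtinger_eq_0:
  assumes "open U" "z \<in> U" "\<And>w. w \<in> U \<Longrightarrow> f w = 0"
  shows "wirtinger g f z = 0"
proof -
  have "(f has_derivative (\<lambda>_. 0)) (at z)"
    using assms by (intro has_derivative_transform_within_open[of "\<lambda>_. 0" "\<lambda>_. 0" z UNIV U f]) auto
  then have "frechet_derivative f (at z) = (\<lambda>_. 0)"
    by (metis frechet_derivative_at)
  then show ?thesis
    by (cases g) simp_all
qed

text \<open>Locality of the operator. Vanishing is assumed on a neighbourhood because the outer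
  derivative needs the inner one to vanish near \<open>z\<close>, not just at
  \<open>z\<close>.\<close>

lemma ddc_eq_0:
  assumes U: "open U" "z \<in> U" "\<And>w S. w \<in> U \<Longrightarrow> \<phi> w S = 0"
  shows "ddc \<phi> z S = 0"
proof -
  have "wirtinger g (\<lambda>w. \<phi> w T) w = 0" if "w \<in> U" for g T w
    using U(3) that by (intro wirtinger_eq_0[OF U(1)])
  then have d: "delbar \<phi> w T = 0" if "w \<in> U" for w T
    unfolding delbar_def wedge_def using that by (simp del: wirtinger.simps)
  have "wirtinger g (\<lambda>w. delbar \<phi> w T) z = 0" for g T
    using d by (intro wirtinger_eq_0[OF U(1,2)])
  then show ?thesis
    unfolding ddc_def del_def wedge_def by (simp del: wirtinger.simps)
qed

text \<open>Reduces currents to functions: the density \<open>g\<close> is the same for every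
  \<open>u\<close>. Its support is enclosed in a bidisc, the shape suited to iterated
  integration.\<close>

lemma ddc_current_eq:
  assumes "\<phi> \<in> test_forms11"
  obtains g R where "continuous_on UNIV g" "R > 0"
    "\<And>z w. g (z, w) \<noteq> 0 \<Longrightarrow> cmod z \<le> R \<and> cmod w \<le> R"
    "\<And>u. ddc_current u \<phi> = (LINT z|lborel. of_real (u z) * g z)"
proof -
  define K where "K = closure {z. \<exists>S. \<phi> z S \<noteq> 0}"
  define g where "g z = (- 2 * \<i>)\<^sup>2 * ddc \<phi> z {Dz1, Dzbar1, Dz2, Dzbar2}" for z
  have sm: "\<And>S. smooth (\<lambda>z. \<phi> z S)" and K: "compact K"
    using assms unfolding test_forms11_def K_def by auto
  have 1: "continuous_on UNIV g"
    unfolding g_def by (intro smooth_imp_continuous smooth_cmult smooth_ddc sm)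
  obtain R where R: "R > 0" "\<And>z. z \<in> K \<Longrightarrow> norm z \<le> R"
    using compact_imp_bounded[OF K] by (auto simp: bounded_pos)
  have 2: "cmod z \<le> R \<and> cmod w \<le> R" if "g (z, w) \<noteq> 0" for z w
  proof -
    have "(z, w) \<in> K"
    proof (rule ccontr)
      assume "(z, w) \<notin> K"
      then have "ddc \<phi> (z, w) {Dz1, Dzbar1, Dz2, Dzbar2} = 0"
        using closure_subset[of "{z. \<exists>S. \<phi> z S \<noteq> 0}"] K
        by (intro ddc_eq_0[of "- K"]) (auto simp: K_def)
      then show False using that by (simp add: g_def)
    qed
    then show ?thesis
      using R(2)[of "(z, w)"] norm_fst_le[of z w] norm_snd_le[of w z] by simp
  qed
  have 3: "ddc_current u \<phi> = (LINT z|lborel. of_real (u z) * g z)" for u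
    by (simp add: ddc_current_def integral_form_def g_def)
  show thesis
    by (rule that[OF 1 R(1) 2 3])
qed

section \<open>Negative moments of polynomials\<close>

text \<open>On the layer 4^-(k+1) \<le> y < 4^-k the left-hand side is at most 2^(k+1). The
  singularity is thus dominated by indicators, which later become discs of known area. The summand 1
  serves y \<ge> 1.\<close>

lemma inverse_sqrt_le_dyadic:
  fixes y :: real
  assumes "y > 0"
  shows "ennreal (sqrt (1 / y)) \<le> 1 + (\<Sum>k. ennreal (2 ^ Suc k) * indicator {..<1 / 4 ^ k} y)"
proof (cases "y < 1")
  case False
  then have "ennreal (sqrt (1 / y)) \<le> 1"
    by (simp add: ennreal_le_1)
  then show ?thesis by (simp add: add_increasing2)
next
  case True
  have "eventually (\<lambda>k. (1/4) ^ k < y) sequentially"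
    using assms by (intro order_tendstoD[OF LIMSEQ_realpow_zero]) auto
  then obtain k0 where "(1/4) ^ k0 < y"
    by (auto simp: eventually_sequentially)
  then have ex: "\<exists>k. 1 / 4 ^ k \<le> y" by (auto simp: power_one_over intro!: exI[of _ k0])
  \<comment> \<open>By minimality \<open>y\<close> lies in the layer just before \<open>m\<close>;
    \<open>y < 1\<close> forces \<open>m > 0\<close>, so that layer exists.\<close>
  define m where "m = (LEAST k. 1 / 4 ^ k \<le> y)"
  have m: "1 / 4 ^ m \<le> y" unfolding m_def by (rule LeastI_ex[OF ex])
  then have "m \<noteq> 0" using True by (intro notI) auto
  then obtain k where k: "m = Suc k" by (cases m) auto
  have "\<not> 1 / 4 ^ k \<le> y"
    using not_less_Least[of k "\<lambda>k. 1 / 4 ^ k \<le> y"] k unfolding m_def by simp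
  then have yk: "y < 1 / 4 ^ k" by simp
  have "1 / y \<le> 4 ^ Suc k"
    using m assms k by (simp add: field_simps)
  also have "\<dots> = (2 ^ Suc k)\<^sup>2"
    by (simp add: power2_eq_square flip: power_mult_distrib)
  finally have "sqrt (1 / y) \<le> 2 ^ Suc k"
    by (rule real_le_lsqrt[rotated]) simp
  then have "ennreal (sqrt (1 / y)) \<le> ennreal (2 ^ Suc k)"
    by (rule ennreal_leI)
  also have "\<dots> = (\<Sum>i\<in>{k}. ennreal (2 ^ Suc i) * indicator {..<1 / 4 ^ i} y)"
    using yk by simp
  also have "\<dots> \<le> (\<Sum>k. ennreal (2 ^ Suc k) * indicator {..<1 / 4 ^ k} y)"
    by (rule sum_le_suminf) auto
  finally show ?thesis by (simp add: add_increasing)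
qed

text \<open>The disc of layer k has area pi R^2 16^-k and weight 2^(k+1), a geometric series of
  ratio 1/8. The bound is independent of \<open>a\<close>, which matters because nothing is known
  about the position of the roots. The total 23/7 pi R^2 is rounded up to 10 pi R^2.\<close>

lemma nn_integral_inverse_sqrt_cball:
  assumes R: "R > 0"
  shows "(\<integral>\<^sup>+z. ennreal (sqrt (R / cmod (z - a))) * indicator (cball 0 R) z \<partial>lborel) \<le> ennreal (10 * R\<^sup>2 * pi)"
proof -
  have emb: "emeasure lborel (ball a r) = ennreal (pi * r\<^sup>2)"
      "emeasure lborel (cball a r) = ennreal (pi * r\<^sup>2)" if "r \<ge> 0" for a :: complex and r
    using that emeasure_cball[of r a] emeasure_ball[of r a] by (simp_all add: unit_ball_vol_2)
  have "(\<integral>\<^sup>+z. ennreal (sqrt (R / cmod (z - a))) * indicator (cball 0 R) z \<partial>lborel) \<le>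
     (\<integral>\<^sup>+z. indicator (cball 0 R) z +
        (\<Sum>k. ennreal (2 ^ Suc k) * indicator (ball a (R / 4 ^ k)) z) \<partial>lborel)"
  proof (intro nn_integral_mono)
    fix z :: complex
    have "ennreal (sqrt (R / cmod (z - a))) \<le> 1 + (\<Sum>k. ennreal (2 ^ Suc k) * indicator (ball a (R / 4 ^ k)) z)"
    \<comment> \<open>At the centre, division by zero makes the left-hand side 0.\<close>
    proof (cases "z = a")
      case False
      have [simp]: "indicator (ball a (R / 4 ^ k)) z = (indicator {..<1 / 4 ^ k} (cmod (z - a) / R) :: ennreal)" for k
        using R by (auto simp: indicator_def dist_norm norm_minus_commute field_simps)
      show ?thesis using inverse_sqrt_le_dyadic[of "cmod (z - a) / R"] False R by simp
    qed simp
    then show "ennreal (sqrt (R / cmod (z - a))) * indicator (cball 0 R) z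
        \<le> indicator (cball 0 R) z + (\<Sum>k. ennreal (2 ^ Suc k) * indicator (ball a (R / 4 ^ k)) z)"
      by (auto simp: indicator_def)
  qed
  also have "\<dots> = emeasure lborel (cball 0 R :: complex set) +
      (\<Sum>k. ennreal (2 ^ Suc k) * emeasure lborel (ball a (R / 4 ^ k)))"
  proof (subst nn_integral_add)
    show "(\<lambda>z. \<Sum>k. ennreal (2 ^ Suc k) * indicator (ball a (R / 4 ^ k)) z) \<in> borel_measurable lborel"
      by (intro borel_measurable_suminf_order borel_measurable_times_ennreal borel_measurable_indicator) simp_all
    show "(indicator (cball 0 R) :: complex \<Rightarrow> ennreal) \<in> borel_measurable lborel"
      by (intro borel_measurable_indicator) simp
    have "(\<integral>\<^sup>+z. (\<Sum>k. ennreal (2 ^ Suc k) * indicator (ball a (R / 4 ^ k)) z) \<partial>lborel) =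
        (\<Sum>k. \<integral>\<^sup>+z. ennreal (2 ^ Suc k) * indicator (ball a (R / 4 ^ k)) z \<partial>lborel)"
      by (intro nn_integral_suminf borel_measurable_times_ennreal borel_measurable_indicator) simp_all
    also have "\<dots> = (\<Sum>k. ennreal (2 ^ Suc k) * emeasure lborel (ball a (R / 4 ^ k)))"
      by (intro suminf_cong nn_integral_cmult_indicator) simp
    finally show "integral\<^sup>N lborel (indicator (cball 0 R :: complex set)) +
        (\<integral>\<^sup>+z. (\<Sum>k. ennreal (2 ^ Suc k) * indicator (ball a (R / 4 ^ k)) z) \<partial>lborel) =
        emeasure lborel (cball 0 R :: complex set) +
        (\<Sum>k. ennreal (2 ^ Suc k) * emeasure lborel (ball a (R / 4 ^ k)))"
      by (simp only: nn_integral_indicator sets_lborel borel_closed closed_cball)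
  qed
  also have "(\<Sum>k. ennreal (2 ^ Suc k) * emeasure lborel (ball a (R / 4 ^ k))) =
      (\<Sum>k. ennreal (2 * pi * R\<^sup>2 * (1/8) ^ k))"
  proof (intro suminf_cong)
    fix k
    have "2 ^ Suc k * (pi * (R / 4 ^ k)\<^sup>2) = 2 * pi * R\<^sup>2 * (2 ^ k / (4 ^ k)\<^sup>2)"
      by (simp add: power_divide)
    also have "2 ^ k / (4 ^ k)\<^sup>2 = (1/8 :: real) ^ k"
      by (simp add: power2_eq_square power_divide flip: power_mult_distrib)
         (simp add: field_simps flip: power_mult_distrib)
    finally show "ennreal (2 ^ Suc k) * emeasure lborel (ball a (R / 4 ^ k)) = ennreal (2 * pi * R\<^sup>2 * (1/8) ^ k)"
      using R by (simp add: emb flip: ennreal_mult)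
  qed
  also have "\<dots> = ennreal (2 * pi * R\<^sup>2 * (8/7))"
  proof -
    have "(\<lambda>k. ennreal (2 * pi * R\<^sup>2 * (1/8) ^ k)) sums ennreal (2 * pi * R\<^sup>2 * (8/7))"
      using sums_mult[OF geometric_sums[of "1/8::real"], of "2 * pi * R\<^sup>2"]
      by (subst sums_ennreal) auto
    then show ?thesis by (simp add: sums_iff)
  qed
  also have "emeasure lborel (cball 0 R :: complex set) + ennreal (2 * pi * R\<^sup>2 * (8/7)) =
      ennreal (pi * R\<^sup>2 + 2 * pi * R\<^sup>2 * (8/7))"
    using R by (subst ennreal_plus) (simp_all add: emb)
  also have "\<dots> \<le> ennreal (10 * R\<^sup>2 * pi)"
    using R by (intro ennreal_leI) (simp add: field_simps)
  finally show ?thesis .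
qed

text \<open>If the root is within 3R of \<open>z0\<close>, bound |z0 - a| by 3R. If it is farther,
  moving from \<open>z0\<close> to \<open>z\<close> changes the distance by at most 2R < 2/3 |z0 -
  a|, so a third of it remains.\<close>

lemma cmod_root_factor_ge:
  assumes "R > 0" "cmod z \<le> R" "cmod z0 \<le> R"
  shows "cmod (z0 - a) * min (1/3) (cmod (z - a) / (3 * R)) \<le> cmod (z - a)"
proof (cases "cmod (z0 - a) \<le> 3 * R")
  case True
  have "cmod (z0 - a) * min (1/3) (cmod (z - a) / (3 * R)) \<le> (3 * R) * (cmod (z - a) / (3 * R))"
    using True assms by (intro mult_mono) auto
  then show ?thesis using assms by simp
next
  case False
  have "cmod (z0 - a) \<le> cmod (z - a) + 2 * R"
    using norm_triangle_ineq[of "z - a" "z0 - z"] norm_triangle_ineq4[of z0 z] assms by simp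
  then have "cmod (z0 - a) * (1/3) \<le> cmod (z - a)"
    using False by simp
  moreover have "cmod (z0 - a) * min (1/3) (cmod (z - a) / (3 * R)) \<le> cmod (z0 - a) * (1/3)"
    by (intro mult_left_mono) auto
  ultimately show ?thesis by linarith
qed

text \<open>The factor bound is applied at every root, and the leading coefficient cancels. Padding
  costs nothing because each extra factor is at most 1/3, and exactly \<open>n\<close> factors match
  the exponent -1/(2n). The second property keeps every distance positive where negative powers are
  taken.\<close>

lemma poly_lower_bound_roots:
  assumes p: "degree p \<le> n" and R: "R > 0" and z0: "cmod z0 \<le> R"
  obtains a where
    "\<And>z. cmod z \<le> R \<Longrightarrow>
       cmod (poly p z0) * (\<Prod>i<n. min (1/3) (cmod (z - a i) / (3 * R))) \<le> cmod (poly p z)"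
    "\<And>z i. cmod z \<le> R \<Longrightarrow> poly p z \<noteq> 0 \<Longrightarrow> i < n \<Longrightarrow> z \<noteq> a i"
proof -
  obtain root where root: "smult (lead_coeff p) (\<Prod>i<degree p. [:-root i, 1:]) = p"
    using complex_poly_decompose' by blast
  have ev: "poly p z = lead_coeff p * (\<Prod>i<degree p. z - root i)" for z
    by (subst root[symmetric], subst poly_smult) (simp add: poly_prod)
  \<comment> \<open>far-away dummy roots pad the list to length \<open>n\<close>\<close>
  define a where "a i = (if i < degree p then root i else of_real (4 * R))" for i
  let ?m = "\<lambda>z i. min (1/3) (cmod (z - a i) / (3 * R))"
  have 1: "cmod (poly p z0) * (\<Prod>i<n. ?m z i) \<le> cmod (poly p z)" if z: "cmod z \<le> R" for z
  proof -
    have "(\<Prod>i<n. ?m z i) = (\<Prod>i<degree p. ?m z i) * (\<Prod>i\<in>{degree p..<n}. ?m z i)"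
      using p by (simp add: lessThan_atLeast0 prod.atLeastLessThan_concat)
    also have "\<dots> \<le> (\<Prod>i<degree p. ?m z i) * 1"
      using R by (intro mult_left_mono prod_le_1 prod_nonneg) auto
    finally have "cmod (poly p z0) * (\<Prod>i<n. ?m z i) \<le> cmod (poly p z0) * (\<Prod>i<degree p. ?m z i)"
      by (intro mult_left_mono) auto
    also have "\<dots> = cmod (lead_coeff p) * (\<Prod>i<degree p. cmod (z0 - a i) * ?m z i)"
      by (simp add: ev norm_mult prod_norm[symmetric] prod.distrib a_def)
    also have "\<dots> \<le> cmod (lead_coeff p) * (\<Prod>i<degree p. cmod (z - a i))"
      using R z z0 by (intro mult_left_mono prod_mono conjI cmod_root_factor_ge) auto
    also have "\<dots> = cmod (poly p z)"
      by (simp add: ev norm_mult prod_norm[symmetric] a_def)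
    finally show ?thesis .
  qed
  have 2: "z \<noteq> a i" if "cmod z \<le> R" "poly p z \<noteq> 0" "i < n" for z i
  proof (cases "i < degree p")
    case True
    then show ?thesis using that(2) unfolding ev[of z] by (auto simp: a_def)
  next
    case False
    then show ?thesis using that(1) R by (auto simp: a_def)
  qed
  show thesis by (rule that[OF 1 2])
qed

text \<open>The reciprocal of a minimum is at most the sum of the reciprocals, and 3 + 3 s^2 \<le>
  (2 (1 + s))^2 for s = sqrt(R/d). A sum can then be integrated term by term.\<close>

lemma min_powr_neg_half_le:
  assumes "R > 0" "d > 0"
  shows "min (1/3) (d / (3 * R)) powr (-1/2) \<le> 2 * (1 + sqrt (R / d))"
proof -
  let ?m = "min (1/3) (d / (3 * R))"
  have m: "?m > 0" using assms by simp
  have "1 / ?m \<le> 3 + 3 * (R / d)"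
    using assms by (auto simp: min_def field_simps)
  also have "\<dots> \<le> (2 * (1 + sqrt (R / d)))\<^sup>2"
  proof -
    have "3 + 3 * (x * x) \<le> (2 * (1 + x))\<^sup>2" if "x \<ge> 0" for x :: real
      using that zero_le_square[of x] by (simp only: power2_eq_square ring_distribs)
    moreover have "sqrt (R / d) * sqrt (R / d) = R / d" "sqrt (R / d) \<ge> 0"
      using assms by (simp_all only: real_sqrt_mult_self abs_of_nonneg real_sqrt_ge_zero divide_nonneg_pos less_imp_le)
    ultimately show ?thesis by metis
  qed
  finally have "sqrt (1 / ?m) \<le> 2 * (1 + sqrt (R / d))"
    using assms by (intro real_le_lsqrt) auto
  moreover have "?m powr (-1/2) = sqrt (1 / ?m)"
    using m by (simp add: powr_minus powr_half_sqrt real_sqrt_divide inverse_eq_divide)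
  ultimately show ?thesis by simp
qed

lemma poly_powr_neg_le:
  assumes p: "degree p \<le> n" and n: "n > 0" and R: "R > 0" and z0: "cmod z0 \<le> R"
    and nz: "poly p z0 \<noteq> 0"
  obtains a where
    "\<And>z. cmod z \<le> R \<Longrightarrow> cmod (poly p z) powr (- 1 / (2 * real n)) \<le>
      cmod (poly p z0) powr (- 1 / (2 * real n)) * (\<Sum>i<n. 2 * (1 + sqrt (R / cmod (z - a i))) / n)"
proof -
  obtain a where a: "\<And>z. cmod z \<le> R \<Longrightarrow>
       cmod (poly p z0) * (\<Prod>i<n. min (1/3) (cmod (z - a i) / (3 * R))) \<le> cmod (poly p z)"
    "\<And>z i. cmod z \<le> R \<Longrightarrow> poly p z \<noteq> 0 \<Longrightarrow> i < n \<Longrightarrow> z \<noteq> a i"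
    using poly_lower_bound_roots[OF p R z0] by blast
  have "cmod (poly p z) powr (- 1 / (2 * real n)) \<le>
      cmod (poly p z0) powr (- 1 / (2 * real n)) * (\<Sum>i<n. 2 * (1 + sqrt (R / cmod (z - a i))) / n)"
    if z: "cmod z \<le> R" for z
  \<comment> \<open>At a zero of \<open>p\<close> the convention \<open>0 powr s = 0\<close> makes
    the left-hand side 0.\<close>
  proof (cases "poly p z = 0")
    case True
    then show ?thesis using R by (auto intro!: mult_nonneg_nonneg sum_nonneg)
  next
    case False
    let ?m = "\<lambda>i. min (1/3) (cmod (z - a i) / (3 * R))"
    have m: "?m i > 0" if "i < n" for i
      using a(2)[OF z False that] R by simp
    have P: "(\<Prod>i<n. ?m i) > 0" by (intro prod_pos) (use m in auto)
    have "cmod (poly p z) powr (- 1 / (2 * real n)) \<le>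
        (cmod (poly p z0) * (\<Prod>i<n. ?m i)) powr (- 1 / (2 * real n))"
      using a(1)[OF z] P nz by (intro powr_mono2') auto
    also have "\<dots> = cmod (poly p z0) powr (- 1 / (2 * real n)) * (\<Prod>i<n. ?m i) powr (- 1 / (2 * real n))"
      by (rule powr_mult)
    \<comment> \<open>Splitting the exponent as (-1/2)(1/n) exhibits a geometric mean of n numbers;
      the arithmetic mean then separates the roots.\<close>
    also have "(\<Prod>i<n. ?m i) powr (- 1 / (2 * real n)) = ((\<Prod>i<n. ?m i) powr (-1/2)) powr (1 / n)"
      by (simp add: powr_powr)
    also have "(\<Prod>i<n. ?m i) powr (-1/2) = (\<Prod>i<n. ?m i powr (-1/2))"
      by (rule prod_powr_distrib)
    also have "(\<Prod>i<n. ?m i powr (-1/2)) powr (1 / n) \<le> (\<Sum>i<n. ?m i powr (-1/2) / n)"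
      using arith_geom_mean[of "{..<n}" "\<lambda>i. ?m i powr (-1/2)"] n by (simp add: lessThan_empty_iff)
    also have "(\<Sum>i<n. ?m i powr (-1/2) / n) \<le> (\<Sum>i<n. 2 * (1 + sqrt (R / cmod (z - a i))) / n)"
      using a(2)[OF z False] R by (intro sum_mono divide_right_mono min_powr_neg_half_le) auto
    finally show ?thesis by (simp add: mult_left_mono)
  qed
  then show thesis by (rule that)
qed

text \<open>Each of the n terms of the mean integrates to at most 2 (1 + 10) pi R^2 / n, whence
  22.\<close>

lemma nn_integral_poly_powr_neg:
  assumes p: "degree p \<le> n" and n: "n > 0" and R: "R > 0" and z0: "cmod z0 \<le> R"
    and nz: "poly p z0 \<noteq> 0"
  shows "(\<integral>\<^sup>+z. ennreal (cmod (poly p z) powr (- 1 / (2 * real n))) * indicator (cball 0 R) z \<partial>lborel)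
    \<le> ennreal (22 * R\<^sup>2 * pi) * ennreal (cmod (poly p z0) powr (- 1 / (2 * real n)))"
proof -
  obtain a where a: "\<And>z. cmod z \<le> R \<Longrightarrow> cmod (poly p z) powr (- 1 / (2 * real n)) \<le>
      cmod (poly p z0) powr (- 1 / (2 * real n)) * (\<Sum>i<n. 2 * (1 + sqrt (R / cmod (z - a i))) / n)"
    using poly_powr_neg_le[OF assms] by blast
  let ?A = "cmod (poly p z0) powr (- 1 / (2 * real n))"
  let ?I = "indicator (cball 0 R) :: complex \<Rightarrow> ennreal"
  have [measurable]: "?I \<in> borel_measurable borel" by (intro borel_measurable_indicator) simp
  have I: "(\<integral>\<^sup>+z. ?I z \<partial>lborel) = ennreal (R\<^sup>2 * pi)"
    using R emeasure_cball[of R "0::complex"] by (simp add: unit_ball_vol_2 mult.commute)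
  have "(\<integral>\<^sup>+z. ennreal (cmod (poly p z) powr (- 1 / (2 * real n))) * ?I z \<partial>lborel) \<le>
     (\<integral>\<^sup>+z. ennreal (?A * (2 / n)) * (\<Sum>i<n. ?I z + ennreal (sqrt (R / cmod (z - a i))) * ?I z) \<partial>lborel)"
  proof (intro nn_integral_mono)
    fix z
    show "ennreal (cmod (poly p z) powr (- 1 / (2 * real n))) * ?I z \<le>
      ennreal (?A * (2 / n)) * (\<Sum>i<n. ?I z + ennreal (sqrt (R / cmod (z - a i))) * ?I z)"
    proof (cases "cmod z \<le> R")
      case True
      have "?A * (\<Sum>i<n. 2 * (1 + sqrt (R / cmod (z - a i))) / n) =
          ?A * (2 / n) * (\<Sum>i<n. 1 + sqrt (R / cmod (z - a i)))"
        unfolding mult.assoc sum_distrib_left by (simp add: mult.assoc)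
      then have "ennreal (cmod (poly p z) powr (- 1 / (2 * real n))) \<le>
          ennreal (?A * (2 / n) * (\<Sum>i<n. 1 + sqrt (R / cmod (z - a i))))"
        using a[OF True] by (simp add: ennreal_leI)
      also have "\<dots> = ennreal (?A * (2 / n)) * (\<Sum>i<n. 1 + ennreal (sqrt (R / cmod (z - a i))))"
        using R by (subst ennreal_mult) (auto intro!: sum_nonneg simp flip: sum_ennreal)
      finally show ?thesis using True by simp
    qed simp
  qed
  also have "\<dots> = ennreal (?A * (2 / n)) *
      (\<Sum>i<n. (\<integral>\<^sup>+z. ?I z \<partial>lborel) + (\<integral>\<^sup>+z. ennreal (sqrt (R / cmod (z - a i))) * ?I z \<partial>lborel))"
    by (simp add: nn_integral_cmult nn_integral_sum nn_integral_add)
  also have "\<dots> \<le> ennreal (?A * (2 / n)) * (\<Sum>i<n. ennreal (R\<^sup>2 * pi) + ennreal (10 * R\<^sup>2 * pi))"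
    unfolding I by (intro mult_left_mono sum_mono add_left_mono nn_integral_inverse_sqrt_cball R) auto
  also have "\<dots> = ennreal (?A * (2 / n)) * ennreal (n * (11 * R\<^sup>2 * pi))"
  proof -
    have "ennreal (R\<^sup>2 * pi) + ennreal (10 * R\<^sup>2 * pi) = ennreal (11 * R\<^sup>2 * pi)"
      by (subst ennreal_plus[symmetric]) auto
    then show ?thesis
      by (simp only: sum_constant card_lessThan ennreal_of_nat_eq_real_of_nat ennreal_mult'[OF of_nat_0_le_iff])
  qed
  also have "\<dots> = ennreal (?A * (2 / n) * (n * (11 * R\<^sup>2 * pi)))"
    by (intro ennreal_mult[symmetric]) auto
  also have "?A * (2 / n) * (n * (11 * R\<^sup>2 * pi)) = (22 * R\<^sup>2 * pi) * ?A"
    using n by simp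
  also have "ennreal \<dots> = ennreal (22 * R\<^sup>2 * pi) * ennreal ?A"
    by (intro ennreal_mult) auto
  finally show ?thesis .
qed

section \<open>Slices of K_n and the negative moment in two variables\<close>

lemma finite_pairs_le: "finite {(i, j). i + j \<le> (n::nat)}"
  by (rule finite_subset[of _ "{..n} \<times> {..n}"]) auto

lemma card_pairs_le: "card {(i, j). i + j \<le> (n::nat)} \<le> (n + 1)\<^sup>2"
proof -
  have "card {(i, j). i + j \<le> (n::nat)} \<le> card ({..n} \<times> {..n})"
    by (intro card_mono) auto
  then show ?thesis by (simp add: power2_eq_square)
qed

lemma Kpoly_eq: "Kpoly c n x = (\<Sum>p\<in>{(i, j). i + j \<le> n}. c p * (fst x ^ fst p * snd x ^ snd p))"
  by (auto simp: Kpoly_def case_prod_unfold mult.assoc)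

lemma continuous_on_Kpoly: "continuous_on A (Kpoly c n)"
  unfolding Kpoly_eq[abs_def] by (intro continuous_intros)

lemma borel_measurable_Kpoly [measurable]: "Kpoly c n \<in> borel_measurable borel"
  by (intro borel_measurable_continuous_onI continuous_on_Kpoly)

lemma Kpoly_poly_fst: "\<exists>p. degree p \<le> n \<and> (\<forall>z. Kpoly c n (z, w) = poly p z)"
proof (intro exI conjI allI)
  let ?p = "\<Sum>x\<in>{(i, j). i + j \<le> n}. monom (c x * w ^ snd x) (fst x)"
  show "degree ?p \<le> n"
    by (intro degree_sum_le finite_pairs_le) (auto intro: order_trans[OF degree_monom_le])
  show "Kpoly c n (z, w) = poly ?p z" for z
    by (auto simp: Kpoly_eq poly_sum poly_monom mult_ac)
qed

lemma Kpoly_poly_snd: "\<exists>p. degree p \<le> n \<and> (\<forall>w. Kpoly c n (z, w) = poly p w)"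
proof (intro exI conjI allI)
  let ?p = "\<Sum>x\<in>{(i, j). i + j \<le> n}. monom (c x * z ^ fst x) (snd x)"
  show "degree ?p \<le> n"
    by (intro degree_sum_le finite_pairs_le) (auto intro: order_trans[OF degree_monom_le])
  show "Kpoly c n (z, w) = poly ?p w" for w
    by (auto simp: Kpoly_eq poly_sum poly_monom mult_ac)
qed

text \<open>Two uses of the one-variable bound: for fixed z, compare K_n(z, w) with K_n(z, w0); then
  compare K_n(z, w0) with K_n(z0, w0). The exponent is the same both times because every slice has
  degree at most n.\<close>

lemma nn_integral_Kpoly_powr_neg:
  assumes n: "n > 0" and R: "R > 0" and z0: "cmod z0 \<le> R" and w0: "cmod w0 \<le> R"
    and nz: "Kpoly c n (z0, w0) \<noteq> 0"
  shows "(\<integral>\<^sup>+x. ennreal (cmod (Kpoly c n x) powr (- 1 / (2 * real n))) *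
      indicator (cball 0 R \<times> cball 0 R) x \<partial>lborel)
    \<le> (ennreal (22 * R\<^sup>2 * pi))\<^sup>2 * ennreal (cmod (Kpoly c n (z0, w0)) powr (- 1 / (2 * real n)))"
proof -
  let ?s = "- 1 / (2 * real n)" and ?C = "ennreal (22 * R\<^sup>2 * pi)"
  let ?I = "indicator (cball 0 R) :: complex \<Rightarrow> ennreal"
  have [measurable]: "?I \<in> borel_measurable borel" by (intro borel_measurable_indicator) simp
  have [measurable]: "(\<lambda>z. Kpoly c n (z, w)) \<in> borel_measurable borel" for w
    by (rule measurable_compose[OF _ borel_measurable_Kpoly]) (simp flip: borel_prod)
  have [measurable]: "Kpoly c n \<in> borel_measurable (borel \<Otimes>\<^sub>M borel)"
    by (simp add: borel_prod)
  obtain p where p: "degree p \<le> n" "\<And>z. Kpoly c n (z, w0) = poly p z"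
    using Kpoly_poly_fst[of n c w0] by blast
  have "p \<noteq> 0" using p(2)[of z0] nz by auto
  then have "finite {z. poly p z = 0}" by (rule poly_roots_finite)
  then have "AE z in lborel. z \<notin> {z. poly p z = 0}"
    by (intro AE_not_in finite_imp_null_set_lborel)
  \<comment> \<open>The inner comparison needs a nonzero value at \<open>w0\<close>; it fails for
    only finitely many z.\<close>
  then have ae: "AE z in lborel. Kpoly c n (z, w0) \<noteq> 0" by (simp add: p)
  have "(\<integral>\<^sup>+x. ennreal (cmod (Kpoly c n x) powr ?s) * indicator (cball 0 R \<times> cball 0 R) x \<partial>lborel) =
      (\<integral>\<^sup>+x. ennreal (cmod (Kpoly c n x) powr ?s) * (?I (fst x) * ?I (snd x)) \<partial>(lborel \<Otimes>\<^sub>M lborel))"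
    unfolding lborel_prod by (intro nn_integral_cong) (auto simp: indicator_def)
  also have "\<dots> = (\<integral>\<^sup>+z. \<integral>\<^sup>+w. ennreal (cmod (Kpoly c n (z, w)) powr ?s) * (?I z * ?I w) \<partial>lborel \<partial>lborel)"
    by (subst lborel.nn_integral_fst[symmetric]) (simp_all, measurable)
  also have "\<dots> \<le> (\<integral>\<^sup>+z. ?C * (ennreal (cmod (Kpoly c n (z, w0)) powr ?s) * ?I z) \<partial>lborel)"
  proof (intro nn_integral_mono_AE)
    show "AE z in lborel. (\<integral>\<^sup>+w. ennreal (cmod (Kpoly c n (z, w)) powr ?s) * (?I z * ?I w) \<partial>lborel)
        \<le> ?C * (ennreal (cmod (Kpoly c n (z, w0)) powr ?s) * ?I z)"
      using ae
    proof eventually_elim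
      case (elim z)
      obtain q where q: "degree q \<le> n" "\<And>w. Kpoly c n (z, w) = poly q w"
        using Kpoly_poly_snd[of n c z] by blast
      have "(\<integral>\<^sup>+w. ennreal (cmod (Kpoly c n (z, w)) powr ?s) * ?I w \<partial>lborel)
        \<le> ?C * ennreal (cmod (Kpoly c n (z, w0)) powr ?s)"
        using elim nn_integral_poly_powr_neg[OF q(1) n R w0] unfolding q(2) by simp
      then show ?case by (cases "cmod z \<le> R") auto
    qed
  qed
  also have "\<dots> = ?C * (\<integral>\<^sup>+z. ennreal (cmod (Kpoly c n (z, w0)) powr ?s) * ?I z \<partial>lborel)"
    by (intro nn_integral_cmult) measurable
  also have "\<dots> \<le> ?C * (?C * ennreal (cmod (Kpoly c n (z0, w0)) powr ?s))"
    using nn_integral_poly_powr_neg[OF p(1) n R z0] nz unfolding p(2) by (intro mult_left_mono) auto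
  finally show ?thesis by (simp add: power2_eq_square mult.assoc)
qed


section \<open>Convergence of the potentials\<close>

text \<open>A second-moment bound gives uniform integrability: split \<open>\<bar>f\<bar> \<le> min \<bar>f\<bar> T + f\<^sup>2 / T\<close>.\<close>

lemma nn_integral_tendsto_0_of_square_bounded:
  fixes f :: "nat \<Rightarrow> 'a \<Rightarrow> real"
  assumes [measurable]: "\<And>n. f n \<in> borel_measurable M" "B \<in> sets M"
    and fin: "emeasure M B < \<infinity>" and lim: "AE x in M. (\<lambda>n. f n x) \<longlonglongrightarrow> 0"
    and sq: "eventually (\<lambda>n. (\<integral>\<^sup>+x. ennreal ((f n x)\<^sup>2) * indicator B x \<partial>M) \<le> ennreal C) sequentially"
  shows "(\<lambda>n. \<integral>\<^sup>+x. ennreal \<bar>f n x\<bar> * indicator B x \<partial>M) \<longlonglongrightarrow> 0"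
proof (rule order_tendstoI)
  fix a :: ennreal assume "0 < a"
  then obtain b where b: "0 < b" "b < a" using dense by blast
  then obtain e where e: "b = ennreal e" "e > 0" by (cases b) auto
  \<comment> \<open>Makes the contribution |C|/T of the squares at most e/2; adding 1 keeps T
    positive when C = 0. The absolute value covers negative \<open>C\<close>, which
    \<open>ennreal\<close> sends to 0.\<close>
  define T where "T = 2 * \<bar>C\<bar> / e + 1"
  have T: "T > 0" "\<bar>C\<bar> / T \<le> e / 2"
  proof -
    show "T > 0" using e by (simp add: T_def add_nonneg_pos)
    then show "\<bar>C\<bar> / T \<le> e / 2" using e by (simp add: T_def field_simps)
  qed
  have "(\<lambda>n. \<integral>\<^sup>+x. ennreal (min \<bar>f n x\<bar> T) * indicator B x \<partial>M) \<longlonglongrightarrow> (\<integral>\<^sup>+x. 0 \<partial>M)"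
  proof (rule nn_integral_dominated_convergence[where w = "\<lambda>x. ennreal T * indicator B x"])
    show "(\<integral>\<^sup>+x. ennreal T * indicator B x \<partial>M) < \<infinity>"
      using fin by (simp add: nn_integral_cmult_indicator ennreal_mult_less_top)
    show "AE x in M. (\<lambda>n. ennreal (min \<bar>f n x\<bar> T) * indicator B x) \<longlonglongrightarrow> 0"
      using lim
    proof eventually_elim
      case (elim x)
      have "(\<lambda>n. min \<bar>f n x\<bar> T) \<longlonglongrightarrow> min \<bar>0\<bar> T"
        by (intro tendsto_intros elim)
      then have "(\<lambda>n. ennreal (min \<bar>f n x\<bar> T)) \<longlonglongrightarrow> ennreal 0"
        using T by (intro tendsto_ennrealI) auto
      then show ?case by (auto simp: indicator_def)
    qed
  qed (auto intro!: AE_I2 ennreal_leI mult_right_mono)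
  then have "eventually (\<lambda>n. (\<integral>\<^sup>+x. ennreal (min \<bar>f n x\<bar> T) * indicator B x \<partial>M) < ennreal (e / 2)) sequentially"
    using e by (intro order_tendstoD) auto
  with sq show "eventually (\<lambda>n. (\<integral>\<^sup>+x. ennreal \<bar>f n x\<bar> * indicator B x \<partial>M) < a) sequentially"
  proof eventually_elim
    case (elim n)
    have "\<bar>f n x\<bar> \<le> min \<bar>f n x\<bar> T + (1 / T) * (f n x)\<^sup>2" for x
    proof (cases "\<bar>f n x\<bar> \<le> T")
      case False
      then have "T * \<bar>f n x\<bar> \<le> \<bar>f n x\<bar> * \<bar>f n x\<bar>"
        by (intro mult_right_mono) auto
      then have "\<bar>f n x\<bar> \<le> (1 / T) * (f n x)\<^sup>2"
        using T by (simp add: field_simps power2_eq_square)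
      then show ?thesis using T by linarith
    qed (use T in auto)
    then have "ennreal \<bar>f n x\<bar> \<le> ennreal (min \<bar>f n x\<bar> T) + ennreal (1 / T) * ennreal ((f n x)\<^sup>2)" for x
      using T by (auto simp flip: ennreal_mult ennreal_plus intro!: ennreal_leI)
    then have "(\<integral>\<^sup>+x. ennreal \<bar>f n x\<bar> * indicator B x \<partial>M) \<le>
        (\<integral>\<^sup>+x. ennreal (min \<bar>f n x\<bar> T) * indicator B x + ennreal (1 / T) * (ennreal ((f n x)\<^sup>2) * indicator B x) \<partial>M)"
      by (intro nn_integral_mono) (auto simp: indicator_def)
    also have "\<dots> = (\<integral>\<^sup>+x. ennreal (min \<bar>f n x\<bar> T) * indicator B x \<partial>M) +
        ennreal (1 / T) * (\<integral>\<^sup>+x. ennreal ((f n x)\<^sup>2) * indicator B x \<partial>M)"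
      by (simp add: nn_integral_add nn_integral_cmult)
    also have "\<dots> \<le> ennreal (e / 2) + ennreal (1 / T) * ennreal \<bar>C\<bar>"
      using elim by (intro add_mono mult_left_mono) (auto intro: order_trans ennreal_leI)
    also have "\<dots> = ennreal (e / 2 + \<bar>C\<bar> / T)"
      using T e by (simp flip: ennreal_mult ennreal_plus)
    also have "\<dots> \<le> ennreal e"
      using T(2) by (intro ennreal_leI) linarith
    also have "\<dots> < a" using b e by simp
    finally show ?case .
  qed
qed simp

section \<open>Growth of V and the upper bound for K_n\<close>

lemma borel_measurable_V [measurable]: "V \<in> borel_measurable borel"
  unfolding V_def borel_prod[symmetric] by measurable

lemma V_nonneg: "V x \<ge> 0"
  by (auto simp: V_def split: prod.split)

lemma cmod_le_exp_V: "cmod (fst x) \<le> exp (V x)" "cmod (snd x) \<le> exp (V x)"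
proof -
  have *: "cmod a \<le> exp r" if "r \<ge> ln (cmod a)" for a r
    using that by (cases "a = 0") (simp, metis exp_le_cancel_iff exp_ln zero_less_norm_iff)
  show "cmod (fst x) \<le> exp (V x)" "cmod (snd x) \<le> exp (V x)"
    by (rule *, simp add: V_def case_prod_unfold max.coboundedI2)+
qed

lemma V_le_of_cball:
  assumes "cmod z \<le> R" "cmod w \<le> R" "R > 0"
  shows "V (z, w) \<le> R"
proof -
  have "ln (cmod a) \<le> R" if "cmod a \<le> R" for a
    using that ln_bound[of "cmod a"] \<open>R > 0\<close> by (cases "a = 0") auto
  then show ?thesis using assms by (simp add: V_def)
qed

text \<open>Says that limsup |c(i,j)|^(1/(i+j)) is at most 1. Together with
  \<open>lower_regular\<close> almost everywhere, it carries all the probabilistic information that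
  the analytic part uses.\<close>

definition subexponential :: "(nat \<times> nat \<Rightarrow> complex) \<Rightarrow> bool" where
  "subexponential c \<longleftrightarrow> (\<forall>\<epsilon>>0. \<exists>C. \<forall>i j. cmod (c (i, j)) \<le> C * exp (\<epsilon> * real (i + j)))"

text \<open>Since V \<ge> 0, every monomial of degree at most n is at most exp(n V). Half of
  \<epsilon> pays for the coefficients, the other half for the constant and the number of monomials,
  so the threshold for n is uniform in x.\<close>

lemma Kpoly_upper_bound:
  assumes c: "subexponential c" and e: "\<epsilon> > 0"
  shows "eventually (\<lambda>n. \<forall>x. cmod (Kpoly c n x) \<le> exp (n * (V x + \<epsilon>))) sequentially"
proof -
  obtain C where "\<forall>i j. cmod (c (i, j)) \<le> C * exp (\<epsilon> / 2 * real (i + j))"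
    using c[unfolded subexponential_def, rule_format, OF half_gt_zero[OF e]] by (elim exE)
  then have C: "cmod (c (i, j)) \<le> C * exp (\<epsilon> / 2 * real (i + j))" for i j
    by (elim allE)
  have C0: "C \<ge> 0" using order_trans[OF norm_ge_zero C[of 0 0]] by simp
  have "eventually (\<lambda>n. real ((n + 1)\<^sup>2) * C \<le> exp (n * (\<epsilon> / 2))) sequentially"
    using e by real_asymp
  then show ?thesis
  proof eventually_elim
    case (elim n)
    show ?case
    proof
      fix x
      have "cmod (c p * (fst x ^ fst p * snd x ^ snd p)) \<le> C * exp (n * (V x + \<epsilon> / 2))"
        if "p \<in> {(i, j). i + j \<le> n}" for p
      proof -
        obtain i j where p: "p = (i, j)" "i + j \<le> n" using \<open>p \<in> _\<close> by auto
        have "cmod (fst x ^ i * snd x ^ j) \<le> exp (V x) ^ i * exp (V x) ^ j"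
          unfolding norm_mult norm_power by (intro mult_mono power_mono cmod_le_exp_V) auto
        also have "\<dots> = exp (real (i + j) * V x)"
          by (simp only: power_add exp_of_nat_mult)
        also have "\<dots> \<le> exp (n * V x)"
          unfolding exp_le_cancel_iff using p by (intro mult_right_mono V_nonneg) simp
        finally have 1: "cmod (fst x ^ i * snd x ^ j) \<le> exp (n * V x)" .
        have "cmod (c p) \<le> C * exp (\<epsilon> / 2 * real (i + j))" using C p by simp
        also have "\<dots> \<le> C * exp (\<epsilon> / 2 * n)"
          using C0 e p by (intro mult_left_mono) auto
        finally have "cmod (c p) * cmod (fst x ^ i * snd x ^ j) \<le> C * exp (\<epsilon> / 2 * n) * exp (n * V x)"
          using C0 by (intro mult_mono 1) auto
        also have "\<dots> = C * exp (n * (V x + \<epsilon> / 2))"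
          by (simp add: algebra_simps exp_add)
        finally show ?thesis by (simp add: p norm_mult)
      qed
      then have "cmod (Kpoly c n x) \<le> (\<Sum>p\<in>{(i, j). i + j \<le> n}. C * exp (n * (V x + \<epsilon> / 2)))"
        unfolding Kpoly_eq by (intro sum_norm_le)
      also have "\<dots> = real (card {(i, j). i + j \<le> n}) * (C * exp (n * (V x + \<epsilon> / 2)))"
        by simp
      also have "\<dots> \<le> real ((n + 1)\<^sup>2) * (C * exp (n * (V x + \<epsilon> / 2)))"
        using C0 card_pairs_le by (intro mult_right_mono) (auto simp del: of_nat_power)
      also have "\<dots> = (real ((n + 1)\<^sup>2) * C) * exp (n * (V x + \<epsilon> / 2))"
        by simp
      also have "\<dots> \<le> exp (n * (\<epsilon> / 2)) * exp (n * (V x + \<epsilon> / 2))"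
        using elim by (intro mult_right_mono) auto
      also have "\<dots> = exp (n * (V x + \<epsilon>))"
        by (simp add: algebra_simps flip: exp_add)
      finally show "cmod (Kpoly c n x) \<le> exp (n * (V x + \<epsilon>))" .
    qed
  qed
qed

section \<open>From pointwise limits to convergence of currents\<close>

abbreviation potential :: "(nat \<times> nat \<Rightarrow> complex) \<Rightarrow> nat \<Rightarrow> C2 \<Rightarrow> real" where
  "potential c n x \<equiv> 1 / real n * ln (cmod (Kpoly c n x))"

text \<open>Here the threshold for n may depend on x, as K_n may have zeros. The condition forces
  K_n(x) to be nonzero for large n, so \<open>ln 0 = 0\<close> does not interfere with the
  limit.\<close>

definition lower_regular :: "(nat \<times> nat \<Rightarrow> complex) \<Rightarrow> C2 \<Rightarrow> bool" where
  "lower_regular c x \<longleftrightarrow>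
     (\<forall>\<epsilon>>0. eventually (\<lambda>n. cmod (Kpoly c n x) \<ge> exp (n * (V x - \<epsilon>))) sequentially)"

lemma potential_le:
  assumes "cmod (Kpoly c n x) \<le> exp (n * (V x + \<epsilon>))" "n > 0" "\<epsilon> > 0"
  shows "potential c n x \<le> V x + \<epsilon>"
\<comment> \<open>At a zero the potential is 0 because \<open>ln 0 = 0\<close>, and V \<ge> 0 saves
  the bound.\<close>
proof (cases "Kpoly c n x = 0")
  case True
  then show ?thesis using V_nonneg[of x] assms by simp
next
  case False
  then have "ln (cmod (Kpoly c n x)) \<le> n * (V x + \<epsilon>)"
    using assms(1) by (metis exp_le_cancel_iff exp_ln zero_less_norm_iff)
  then show ?thesis using assms(2) by (simp add: field_simps)
qed

lemma potential_tendsto: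
  assumes "subexponential c" "lower_regular c x"
  shows "(\<lambda>n. potential c n x) \<longlonglongrightarrow> V x"
proof (rule tendstoI)
  fix e :: real assume "e > 0"
  then have "e / 2 > 0" by simp
  from Kpoly_upper_bound[OF assms(1) this] assms(2)[unfolded lower_regular_def, rule_format, OF this]
    eventually_gt_at_top[of 0]
  show "eventually (\<lambda>n. dist (potential c n x) (V x) < e) sequentially"
  proof eventually_elim
    case (elim n)
    have "cmod (Kpoly c n x) > 0" using elim(2) exp_gt_zero less_le_trans by blast
    then have "n * (V x - e / 2) \<le> ln (cmod (Kpoly c n x))"
      using elim(2) by (simp add: ln_ge_iff)
    then have "V x - e / 2 \<le> potential c n x"
      using elim(3) by (simp add: field_simps)
    moreover have "potential c n x \<le> V x + e / 2"
      by (rule potential_le[OF spec[OF elim(1)] elim(3) \<open>e / 2 > 0\<close>])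
    moreover have "\<bar>a - b\<bar> < e" if "b - e / 2 \<le> a" "a \<le> b + e / 2" for a b :: real
      using that \<open>e > 0\<close> by linarith
    ultimately show ?case unfolding dist_real_def by blast
  qed
qed

lemma square_le_exp_half:
  fixes x :: real
  assumes "x \<ge> 0"
  shows "x\<^sup>2 \<le> 8 * exp (x / 2)"
proof -
  have "1 + x / 2 + (x / 2)\<^sup>2 / 2 \<le> exp (x / 2)"
    using assms by (intro exp_lower_Taylor_quadratic) auto
  then have "(x / 2)\<^sup>2 / 2 \<le> exp (x / 2)" using assms by linarith
  then show ?thesis by (simp add: power_divide)
qed

text \<open>Above V the difference is at most 1 by the upper bound. Below V, the square is at most 8
  exp((V - u)/2), and exp(-u/2) is |K_n|^(-1/(2n)) off the zeros: the integrand of the negative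
  moment.\<close>

lemma potential_square_bound:
  assumes "cmod (Kpoly c n x) \<le> exp (n * (V x + 1))" "n > 0" and R: "V x \<le> R"
  shows "(potential c n x - V x)\<^sup>2 \<le>
    1 + 8 * exp (R / 2) + 8 * exp (R / 2) * cmod (Kpoly c n x) powr (- 1 / (2 * real n))"
proof (cases "potential c n x \<ge> V x")
  case True
  with potential_le[OF assms(1,2)] have "\<bar>potential c n x - V x\<bar> \<le> 1" by simp
  then have "(potential c n x - V x)\<^sup>2 \<le> 1" by (simp only: abs_square_le_1)
  then show ?thesis by (simp add: add_increasing2)
next
  case False
  have "(potential c n x - V x)\<^sup>2 = (V x - potential c n x)\<^sup>2"
    by (rule power2_commute)
  also have "\<dots> \<le> 8 * exp ((V x - potential c n x) / 2)"
    using False by (intro square_le_exp_half) simp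
  also have "\<dots> \<le> 8 * (exp (R / 2) * exp (- potential c n x / 2))"
    using R by (simp flip: exp_add add: diff_divide_distrib)
  also have "exp (- potential c n x / 2) \<le> 1 + cmod (Kpoly c n x) powr (- 1 / (2 * real n))"
  \<comment> \<open>At a zero the potential is 0 by convention and the power is 0, so the summand 1
    is needed.\<close>
  proof (cases "Kpoly c n x = 0")
    case False
    then have "exp (- potential c n x / 2) = cmod (Kpoly c n x) powr (- 1 / (2 * real n))"
      by (simp add: powr_def mult.commute)
    then show ?thesis by simp
  qed simp
  finally show ?thesis by (simp add: algebra_simps)
qed

text \<open>One regular point controls the whole bidisc: there |K_n|^(-1/(2n)) \<le> exp((1 - V)/2)
  \<le> e for all large n, so the moment bound is independent of n.\<close>

lemma potential_square_integral_bounded: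
  assumes c: "subexponential c" and x0: "lower_regular c (z0, w0)"
    and R: "R > 0" "cmod z0 \<le> R" "cmod w0 \<le> R"
  obtains C where "eventually (\<lambda>n. (\<integral>\<^sup>+x. ennreal ((potential c n x - V x)\<^sup>2) *
    indicator (cball 0 R \<times> cball 0 R) x \<partial>lborel) \<le> ennreal C) sequentially"
proof -
  let ?B = "cball 0 R \<times> cball 0 R :: C2 set"
  define a where "a = 8 * exp (R / 2)"
  define E where "E = (22 * R\<^sup>2 * pi)\<^sup>2 * exp 1"
  have a: "a \<ge> 0" and E: "E \<ge> 0" by (simp_all add: a_def E_def)
  have B [measurable]: "?B \<in> sets borel" by (intro borel_closed closed_Times closed_cball)
  have "emeasure lborel ?B < \<infinity>"
    by (intro emeasure_bounded_finite bounded_Times bounded_cball)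
  then obtain m where m: "emeasure lborel ?B = ennreal m" "m \<ge> 0"
    by (cases "emeasure lborel ?B") auto
  from Kpoly_upper_bound[OF c zero_less_one] x0[unfolded lower_regular_def, rule_format, OF zero_less_one]
    eventually_gt_at_top[of 0]
  have "eventually (\<lambda>n. (\<integral>\<^sup>+x. ennreal ((potential c n x - V x)\<^sup>2) * indicator ?B x \<partial>lborel)
      \<le> ennreal ((1 + a) * m + a * E)) sequentially"
  proof eventually_elim
    case (elim n)
    let ?k = "\<lambda>x. cmod (Kpoly c n x) powr (- 1 / (2 * real n))"
    have nz: "Kpoly c n (z0, w0) \<noteq> 0"
      using elim(2) by (metis exp_gt_zero norm_zero not_less)
    have "?k (z0, w0) \<le> exp (n * (V (z0, w0) - 1)) powr (- 1 / (2 * real n))"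
      using elim(2,3) by (intro powr_mono2') auto
    also have "\<dots> = exp ((1 - V (z0, w0)) / 2)"
      using elim(3) by (simp add: powr_def field_simps)
    also have "\<dots> \<le> exp 1"
      using V_nonneg[of "(z0, w0)"] by simp
    finally have k: "?k (z0, w0) \<le> exp 1" .
    have mom: "(\<integral>\<^sup>+x. ennreal (?k x) * indicator ?B x \<partial>lborel) \<le>
        (ennreal (22 * R\<^sup>2 * pi))\<^sup>2 * ennreal (exp 1)"
      by (rule order_trans[OF nn_integral_Kpoly_powr_neg[OF elim(3) R nz]])
         (intro mult_left_mono ennreal_leI k zero_le)
    have "(\<integral>\<^sup>+x. ennreal ((potential c n x - V x)\<^sup>2) * indicator ?B x \<partial>lborel) \<le>
        (\<integral>\<^sup>+x. ennreal (1 + a) * indicator ?B x + ennreal a * (ennreal (?k x) * indicator ?B x) \<partial>lborel)"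
    proof (intro nn_integral_mono)
      fix x
      show "ennreal ((potential c n x - V x)\<^sup>2) * indicator ?B x \<le>
        ennreal (1 + a) * indicator ?B x + ennreal a * (ennreal (?k x) * indicator ?B x)"
      proof (cases "x \<in> ?B")
        case True
        then have "V x \<le> R" using V_le_of_cball[of "fst x" R "snd x"] R by (cases x) auto
        then have "(potential c n x - V x)\<^sup>2 \<le> (1 + a) + a * ?k x"
          using potential_square_bound[OF spec[OF elim(1)] elim(3)] unfolding a_def by blast
        then have "ennreal ((potential c n x - V x)\<^sup>2) \<le> ennreal ((1 + a) + a * ?k x)"
          by (rule ennreal_leI)
        also have "\<dots> = ennreal (1 + a) + ennreal a * ennreal (?k x)"
          using a by (subst ennreal_plus) (auto simp: ennreal_mult)
        finally show ?thesis using True by simp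
      qed simp
    qed
    also have "\<dots> = ennreal (1 + a) * emeasure lborel ?B +
        ennreal a * (\<integral>\<^sup>+x. ennreal (?k x) * indicator ?B x \<partial>lborel)"
      by (subst nn_integral_add) (simp_all add: nn_integral_cmult nn_integral_cmult_indicator)
    also have "\<dots> \<le> ennreal (1 + a) * ennreal m +
        ennreal a * ((ennreal (22 * R\<^sup>2 * pi))\<^sup>2 * ennreal (exp 1))"
      unfolding m(1) by (intro add_left_mono mult_left_mono mom zero_le)
    also have "\<dots> = ennreal ((1 + a) * m + a * E)"
    proof -
      have "(ennreal (22 * R\<^sup>2 * pi))\<^sup>2 * ennreal (exp 1) = ennreal E"
      proof -
        have "(ennreal x)\<^sup>2 * ennreal (exp 1) = ennreal (x\<^sup>2 * exp 1)" if "x \<ge> 0" for x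
          using that by (simp add: ennreal_mult ennreal_power)
        then show ?thesis unfolding E_def by simp
      qed
      then show ?thesis
        using a E m by (simp add: ennreal_plus ennreal_mult)
    qed
    finally show ?case .
  qed
  then show thesis by (rule that)
qed

text \<open>The error in the pairing is at most \<open>G\<close> times the integral of |u_n - V|
  over the bidisc, where \<open>G\<close> bounds the density of the test form.\<close>

lemma current_tendsto_of_regular:
  assumes c: "subexponential c" and reg: "AE x in lborel. lower_regular c x"
  shows "current_tendsto (Z_current c) (ddc_current V)"
  unfolding current_tendsto_def
proof
  fix \<phi> assume "\<phi> \<in> test_forms11"
  then obtain g R0 where g: "continuous_on UNIV g" and R0: "R0 > 0"
    and supp: "\<And>z w. g (z, w) \<noteq> 0 \<Longrightarrow> cmod z \<le> R0 \<and> cmod w \<le> R0"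
    and cur: "\<And>u. ddc_current u \<phi> = (LINT z|lborel. of_real (u z) * g z)"
    using ddc_current_eq by blast
  have [measurable]: "g \<in> borel_measurable borel"
    using g by (rule borel_measurable_continuous_onI)
  \<comment> \<open>A property that holds almost everywhere holds somewhere; this yields the
    reference point for the negative moment.\<close>
  have "\<exists>x. lower_regular c x"
  proof (rule ccontr)
    assume "\<nexists>x. lower_regular c x"
    then have "lower_regular c = (\<lambda>_. False)" by blast
    then have "AE x in (lborel :: C2 measure). False" using reg by (simp only:)
    then have "emeasure lborel (UNIV :: C2 set) = 0"
      by (subst (asm) AE_iff_measurable[OF _ refl]) simp_all
    then show False by simp
  qed
  then obtain z0 w0 where x0: "lower_regular c (z0, w0)" by (metis surj_pair)
  define R where "R = max R0 (max (cmod z0) (cmod w0))"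
  have R: "R > 0" "cmod z0 \<le> R" "cmod w0 \<le> R" "R0 \<le> R" using R0 by (auto simp: R_def)
  let ?B = "cball 0 R \<times> cball 0 R :: C2 set"
  have B [measurable]: "?B \<in> sets borel" by (intro borel_closed closed_Times closed_cball)
  have fin: "emeasure lborel ?B < \<infinity>"
    by (intro emeasure_bounded_finite bounded_Times bounded_cball)
  have g0: "g x = 0" if "x \<notin> ?B" for x
    using supp[of "fst x" "snd x"] that R(4) by (cases x) force
  have "compact (g ` ?B)"
    using g by (intro compact_continuous_image compact_Times compact_cball) (auto intro: continuous_on_subset)
  then obtain G where G: "G > 0" "\<And>x. x \<in> ?B \<Longrightarrow> cmod (g x) \<le> G"
    using compact_imp_bounded[of "g ` ?B"] by (auto simp: bounded_pos)
  define d where "d n x = potential c n x - V x" for n x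
  have [measurable]: "d n \<in> borel_measurable borel" for n
    unfolding d_def by measurable
  obtain C where "eventually (\<lambda>n. (\<integral>\<^sup>+x. ennreal ((d n x)\<^sup>2) * indicator ?B x \<partial>lborel) \<le> ennreal C) sequentially"
    using potential_square_integral_bounded[OF c x0 R(1-3)] unfolding d_def by blast
  moreover have "AE x in lborel. (\<lambda>n. d n x) \<longlonglongrightarrow> 0"
    using reg
  proof eventually_elim
    case (elim x)
    show ?case
      using tendsto_diff[OF potential_tendsto[OF c elim] tendsto_const[of "V x"]] by (simp add: d_def)
  qed
  ultimately have L1: "(\<lambda>n. \<integral>\<^sup>+x. ennreal \<bar>d n x\<bar> * indicator ?B x \<partial>lborel) \<longlonglongrightarrow> 0"
    using fin by (intro nn_integral_tendsto_0_of_square_bounded) auto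
  have nrm: "ennreal (norm (of_real (u x) * g x)) \<le> ennreal G * (ennreal \<bar>u x\<bar> * indicator ?B x)" for u :: "C2 \<Rightarrow> real" and x
  proof (cases "x \<in> ?B")
    case True
    then have "norm (of_real (u x) * g x) \<le> G * \<bar>u x\<bar>"
      using G(2)[OF True] by (simp add: norm_mult mult.commute[of G] mult_left_mono)
    then have "ennreal (norm (of_real (u x) * g x)) \<le> ennreal (G * \<bar>u x\<bar>)" by (rule ennreal_leI)
    then show ?thesis using True G(1) by (simp add: ennreal_mult)
  qed (simp add: g0)
  have int: "integrable lborel (\<lambda>x. of_real (u x) * g x)"
    and le: "ennreal (norm (LINT x|lborel. of_real (u x) * g x)) \<le> ennreal G * (\<integral>\<^sup>+x. ennreal \<bar>u x\<bar> * indicator ?B x \<partial>lborel)"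
    if [measurable]: "u \<in> borel_measurable borel" and "(\<integral>\<^sup>+x. ennreal \<bar>u x\<bar> * indicator ?B x \<partial>lborel) < \<infinity>" for u :: "C2 \<Rightarrow> real"
  proof -
    have 1: "(\<integral>\<^sup>+x. ennreal (norm (of_real (u x) * g x)) \<partial>lborel) \<le>
        ennreal G * (\<integral>\<^sup>+x. ennreal \<bar>u x\<bar> * indicator ?B x \<partial>lborel)"
      by (subst nn_integral_cmult[symmetric]) (measurable, intro nn_integral_mono nrm)
    also have "\<dots> < \<infinity>" using that(2) by (simp add: ennreal_mult_less_top)
    finally show int: "integrable lborel (\<lambda>x. of_real (u x) * g x)"
      by (intro integrableI_bounded) measurable
    show "ennreal (norm (LINT x|lborel. of_real (u x) * g x)) \<le> ennreal G * (\<integral>\<^sup>+x. ennreal \<bar>u x\<bar> * indicator ?B x \<partial>lborel)"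
      using integral_norm_bound_ennreal[OF int] 1 by (rule order_trans)
  qed
  have Vfin: "(\<integral>\<^sup>+x. ennreal \<bar>V x\<bar> * indicator ?B x \<partial>lborel) < \<infinity>"
  proof -
    have "(\<integral>\<^sup>+x. ennreal \<bar>V x\<bar> * indicator ?B x \<partial>lborel) \<le> (\<integral>\<^sup>+x. ennreal R * indicator ?B x \<partial>lborel)"
    proof (intro nn_integral_mono)
      fix x
      show "ennreal \<bar>V x\<bar> * indicator ?B x \<le> ennreal R * indicator ?B x"
        using V_le_of_cball[of "fst x" R "snd x"] R(1) V_nonneg[of x]
        by (cases x) (auto simp: indicator_def intro!: ennreal_leI)
    qed
    also have "\<dots> < \<infinity>" using fin by (simp add: nn_integral_cmult_indicator ennreal_mult_less_top)
    finally show ?thesis .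
  qed
  have "((\<lambda>n. ennreal G * (\<integral>\<^sup>+x. ennreal \<bar>d n x\<bar> * indicator ?B x \<partial>lborel)) \<longlongrightarrow> ennreal G * 0) sequentially"
    by (intro ennreal_tendsto_cmult L1) simp
  then have lim0: "((\<lambda>n. ennreal G * (\<integral>\<^sup>+x. ennreal \<bar>d n x\<bar> * indicator ?B x \<partial>lborel)) \<longlongrightarrow> 0) sequentially"
    by simp
  \<comment> \<open>Splitting the integral requires integrability, since a non-integrable function
    has integral 0 by default; L^1 convergence gives it for large n.\<close>
  have ev: "eventually (\<lambda>n. (\<integral>\<^sup>+x. ennreal \<bar>d n x\<bar> * indicator ?B x \<partial>lborel) < \<infinity>) sequentially"
    using L1 by (intro order_tendstoD(2)) auto
  have "(\<lambda>n. ennreal (norm (Z_current c n \<phi> - ddc_current V \<phi>))) \<longlonglongrightarrow> 0"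
  proof (rule tendsto_sandwich[OF _ _ tendsto_const lim0])
    show "eventually (\<lambda>n. ennreal (norm (Z_current c n \<phi> - ddc_current V \<phi>)) \<le>
        ennreal G * (\<integral>\<^sup>+x. ennreal \<bar>d n x\<bar> * indicator ?B x \<partial>lborel)) sequentially"
      using ev
    proof eventually_elim
      case (elim n)
      have "Z_current c n \<phi> = (LINT x|lborel. of_real (d n x) * g x + of_real (V x) * g x)"
        unfolding Z_current_def cur by (intro Bochner_Integration.integral_cong) (auto simp: d_def algebra_simps)
      also have "\<dots> = (LINT x|lborel. of_real (d n x) * g x) + ddc_current V \<phi>"
        unfolding cur using elim Vfin by (intro Bochner_Integration.integral_add int) auto
      finally show ?case using le[OF _ elim] by simp
    qed
  qed simp
  then have "(\<lambda>n. norm (Z_current c n \<phi> - ddc_current V \<phi>)) \<longlonglongrightarrow> 0"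
    by (subst (asm) ennreal_0[symmetric], subst (asm) tendsto_ennreal_iff) auto
  then show "(\<lambda>n. Z_current c n \<phi>) \<longlonglongrightarrow> ddc_current V \<phi>"
    by (simp add: tendsto_norm_zero_iff LIM_zero_iff)
qed

section \<open>Small ball probabilities\<close>

text \<open>Either \<open>\<bar>Y\<bar> > B\<close>, and for fixed \<open>Y\<close> the variable \<open>X\<close> lies in a small ball; or
  \<open>X\<close> lies in the ball of radius \<open>\<rho>\<close>, and for fixed \<open>X\<close> the variable \<open>Y\<close> lies in a
  ball of radius \<open>r0\<close>.\<close>

lemma (in prob_space) small_ball_add:
  fixes X Y :: "'a \<Rightarrow> complex"
  assumes indep: "indep_var borel X borel Y"
    and Y: "\<And>y. measure (distr M borel Y) {z. cmod z > B \<or> cmod (z - y) \<le> r0} \<le> q"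
    and X: "\<And>x. prob {\<omega> \<in> space M. cmod (X \<omega> - x) \<le> \<rho>} \<le> b"
    and c: "c \<noteq> 0" "r \<le> r0 * cmod c" "r + B * cmod c \<le> \<rho>" and B: "B \<ge> 0"
  shows "prob {\<omega> \<in> space M. cmod (X \<omega> + c * Y \<omega> - x) \<le> r} \<le> b * q"
proof -
  have [measurable]: "X \<in> borel_measurable M" "Y \<in> borel_measurable M"
    using indep by (auto dest: indep_var_rv1 indep_var_rv2)
  define PX where "PX = distr M borel X"
  define PY where "PY = distr M borel Y"
  interpret PX: prob_space PX unfolding PX_def by (rule prob_space_distr) simp
  interpret PY: prob_space PY unfolding PY_def by (rule prob_space_distr) simp
  interpret PXY: pair_prob_space PX PY ..
  have [measurable_cong, simp]: "sets PX = sets borel" "sets PY = sets borel"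
    and [simp]: "space PX = UNIV" "space PY = UNIV"
    by (simp_all add: PX_def PY_def)
  have PX_le: "emeasure PX {z. cmod (z - x) \<le> \<rho>} \<le> ennreal b" for x
  proof -
    have "emeasure PX {z. cmod (z - x) \<le> \<rho>} = ennreal (prob {\<omega> \<in> space M. cmod (X \<omega> - x) \<le> \<rho>})"
      unfolding PX_def by (subst emeasure_distr) (auto simp: emeasure_eq_measure vimage_def Int_def conj_commute)
    also have "\<dots> \<le> ennreal b" using X by (rule ennreal_leI)
    finally show ?thesis .
  qed
  have b0: "b \<ge> 0" using X[of 0] measure_nonneg order_trans by blast
  \<comment> \<open>The budget \<open>q\<close> is split: \<open>q1\<close> goes to large Y, and at
    most \<open>q - q1\<close> remains for Y bounded and near y. This is why Y is controlled on the
    union of the two events.\<close>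
  define q1 where "q1 = PY.prob {z. cmod z > B}"
  have PY_le: "emeasure PY {z. cmod z \<le> B \<and> cmod (z - y) \<le> r0} \<le> ennreal (q - q1)" for y
  proof -
    have "PY.prob {z. cmod z \<le> B \<and> cmod (z - y) \<le> r0} + q1 =
        PY.prob ({z. cmod z \<le> B \<and> cmod (z - y) \<le> r0} \<union> {z. cmod z > B})"
      unfolding q1_def by (subst PY.finite_measure_Union) auto
    also have "{z. cmod z \<le> B \<and> cmod (z - y) \<le> r0} \<union> {z. cmod z > B} =
        {z. cmod z > B \<or> cmod (z - y) \<le> r0}" by auto
    also have "PY.prob \<dots> \<le> q" using Y by (simp add: PY_def)
    finally show ?thesis by (simp add: PY.emeasure_eq_measure ennreal_leI)
  qed
  have q1: "0 \<le> q1" "q1 \<le> q"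
  proof -
    show "0 \<le> q1" by (simp add: q1_def)
    have "q1 \<le> PY.prob {z. cmod z > B \<or> cmod (z - 0) \<le> r0}"
      unfolding q1_def by (intro PY.finite_measure_mono) auto
    also have "\<dots> \<le> q" using Y unfolding PY_def by blast
    finally show "q1 \<le> q" .
  qed
  define S1 where "S1 = {(u, y). cmod y > B \<and> cmod (u + c * y - x) \<le> r}"
  define S2 where "S2 = {(u, y). cmod y \<le> B \<and> cmod (u + c * y - x) \<le> r}"
  have [measurable]: "S1 \<in> sets (PX \<Otimes>\<^sub>M PY)" "S2 \<in> sets (PX \<Otimes>\<^sub>M PY)"
  proof -
    have "Measurable.pred (PX \<Otimes>\<^sub>M PY) (\<lambda>p. cmod (snd p) > B \<and> cmod (fst p + c * snd p - x) \<le> r)"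
      "Measurable.pred (PX \<Otimes>\<^sub>M PY) (\<lambda>p. cmod (snd p) \<le> B \<and> cmod (fst p + c * snd p - x) \<le> r)"
      by measurable
    then show "S1 \<in> sets (PX \<Otimes>\<^sub>M PY)" "S2 \<in> sets (PX \<Otimes>\<^sub>M PY)"
      by (simp_all add: pred_def space_pair_measure S1_def S2_def case_prod_unfold)
  qed
  have "emeasure (PX \<Otimes>\<^sub>M PY) S1 = (\<integral>\<^sup>+y. emeasure PX ((\<lambda>u. (u, y)) -` S1) \<partial>PY)"
    by (intro PXY.emeasure_pair_measure_alt2) measurable
  also have "\<dots> \<le> (\<integral>\<^sup>+y. ennreal b * indicator {z. cmod z > B} y \<partial>PY)"
  proof (intro nn_integral_mono)
    fix y
    show "emeasure PX ((\<lambda>u. (u, y)) -` S1) \<le> ennreal b * indicator {z. cmod z > B} y"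
    proof (cases "cmod y > B")
      case True
      have "r \<le> \<rho>" using c(3) B mult_nonneg_nonneg[OF B norm_ge_zero[of c]] by linarith
      then have "emeasure PX ((\<lambda>u. (u, y)) -` S1) \<le> emeasure PX {z. cmod (z - (x - c * y)) \<le> \<rho>}"
        by (intro emeasure_mono) (auto simp: S1_def algebra_simps)
      then show ?thesis using PX_le True order_trans by fastforce
    qed (simp add: S1_def)
  qed
  also have "\<dots> = ennreal b * ennreal q1"
    by (subst nn_integral_cmult_indicator) (simp_all add: q1_def PY.emeasure_eq_measure)
  finally have 1: "emeasure (PX \<Otimes>\<^sub>M PY) S1 \<le> ennreal (b * q1)"
    using b0 by (simp add: ennreal_mult')
  have "emeasure (PX \<Otimes>\<^sub>M PY) S2 = (\<integral>\<^sup>+u. emeasure PY (Pair u -` S2) \<partial>PX)"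
    by (intro PY.emeasure_pair_measure_alt) measurable
  also have "\<dots> \<le> (\<integral>\<^sup>+u. ennreal (q - q1) * indicator {z. cmod (z - x) \<le> \<rho>} u \<partial>PX)"
  proof (intro nn_integral_mono)
    fix u
    \<comment> \<open>With |y| \<le> B the new term moves the sum by at most B |c|, so u must
      already be within r + B |c| \<le> \<rho> of x.\<close>
    have "Pair u -` S2 = {}" if "\<not> cmod (u - x) \<le> \<rho>"
    proof -
      have "\<not> cmod (u + c * y - x) \<le> r" if "cmod y \<le> B" for y
      proof
        assume "cmod (u + c * y - x) \<le> r"
        moreover have "cmod (u - x) \<le> cmod (u + c * y - x) + cmod (c * y)"
          using norm_triangle_ineq4[of "u + c * y - x" "c * y"] by simp
        moreover have "cmod (c * y) \<le> B * cmod c"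
          using that by (simp add: norm_mult mult.commute[of B] mult_left_mono)
        ultimately show False using c(3) \<open>\<not> cmod (u - x) \<le> \<rho>\<close> by linarith
      qed
      then show ?thesis by (auto simp: S2_def)
    qed
    moreover have "emeasure PY (Pair u -` S2) \<le> ennreal (q - q1)"
    proof -
      have "cmod (y - (x - u) / c) \<le> r0" if "cmod (u + c * y - x) \<le> r" for y
      proof -
        have "c * ((x - u) / c) = x - u" using c(1) by simp
        then have "u + c * y - x = c * (y - (x - u) / c)"
          unfolding right_diff_distrib[of c] by simp
        then have "cmod c * cmod (y - (x - u) / c) = cmod (u + c * y - x)"
          by (simp add: norm_mult)
        with that c have "cmod c * cmod (y - (x - u) / c) \<le> cmod c * r0"
          by (simp add: mult.commute)
        then show ?thesis using c(1) by simp
      qed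
      then have "emeasure PY (Pair u -` S2) \<le> emeasure PY {z. cmod z \<le> B \<and> cmod (z - (x - u) / c) \<le> r0}"
        by (intro emeasure_mono) (auto simp: S2_def)
      also have "\<dots> \<le> ennreal (q - q1)" by (rule PY_le)
      finally show ?thesis .
    qed
    ultimately show "emeasure PY (Pair u -` S2) \<le> ennreal (q - q1) * indicator {z. cmod (z - x) \<le> \<rho>} u"
      by (cases "cmod (u - x) \<le> \<rho>") auto
  qed
  also have "\<dots> \<le> ennreal (q - q1) * ennreal b"
    by (subst nn_integral_cmult_indicator) (auto intro!: mult_left_mono PX_le)
  finally have 2: "emeasure (PX \<Otimes>\<^sub>M PY) S2 \<le> ennreal (b * (q - q1))"
    using b0 q1 by (simp add: ennreal_mult mult.commute)
  have "emeasure M {\<omega> \<in> space M. cmod (X \<omega> + c * Y \<omega> - x) \<le> r} =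
      emeasure (distr M (borel \<Otimes>\<^sub>M borel) (\<lambda>\<omega>. (X \<omega>, Y \<omega>))) (S1 \<union> S2)"
    by (subst emeasure_distr)
       (auto simp: S1_def S2_def intro!: arg_cong[where f = "emeasure M"] sets.Un
         \<open>S1 \<in> sets (PX \<Otimes>\<^sub>M PY)\<close>[unfolded S1_def, simplified] \<open>S2 \<in> sets (PX \<Otimes>\<^sub>M PY)\<close>[unfolded S2_def, simplified])
  also have "\<dots> = emeasure (PX \<Otimes>\<^sub>M PY) (S1 \<union> S2)"
    using indep by (simp add: indep_var_distribution_eq PX_def PY_def)
  also have "\<dots> \<le> emeasure (PX \<Otimes>\<^sub>M PY) S1 + emeasure (PX \<Otimes>\<^sub>M PY) S2"
    by (intro emeasure_subadditive) measurable
  also have "\<dots> \<le> ennreal (b * q1) + ennreal (b * (q - q1))"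
    by (intro add_mono 1 2)
  also have "\<dots> = ennreal (b * q1 + b * (q - q1))"
    using b0 q1 by (intro ennreal_plus[symmetric]) auto
  also have "b * q1 + b * (q - q1) = b * q"
    by (simp add: algebra_simps)
  finally show ?thesis
    using b0 q1 by (simp add: emeasure_eq_measure)
qed

lemma (in prob_space) indep_var_linear_combination:
  fixes \<xi> :: "'i \<Rightarrow> 'a \<Rightarrow> complex"
  assumes "indep_vars (\<lambda>_. borel) \<xi> UNIV" "finite I" "j \<notin> I"
  shows "indep_var borel (\<lambda>\<omega>. \<Sum>i\<in>I. c i * \<xi> i \<omega>) borel (\<xi> j)"
proof -
  have "indep_var
    borel ((\<lambda>f. \<Sum>i\<in>I. c i * f i) \<circ> (\<lambda>\<omega>. restrict (\<lambda>i. \<xi> i \<omega>) I))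
    borel ((\<lambda>f. f j) \<circ> (\<lambda>\<omega>. restrict (\<lambda>i. \<xi> i \<omega>) {j}))"
    using assms by (intro indep_var_compose[OF indep_var_restrict[OF assms(1)]]) auto
  also have "((\<lambda>f. f j) \<circ> (\<lambda>\<omega>. restrict (\<lambda>i. \<xi> i \<omega>) {j})) = \<xi> j"
    by auto
  also have "((\<lambda>f. \<Sum>i\<in>I. c i * f i) \<circ> (\<lambda>\<omega>. restrict (\<lambda>i. \<xi> i \<omega>) I)) = (\<lambda>\<omega>. \<Sum>i\<in>I. c i * \<xi> i \<omega>)"
    by (auto simp: fun_eq_iff)
  finally show ?thesis .
qed

text \<open>The radius is fixed by the requirements of one step: (r0 + B) t \<le> r0 puts the next
  radius below r0 |c|, and r0 |c| + B |c| is exactly the current radius. \<open>F\<close> holds the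
  terms of unrestricted size, present from the start; the induction therefore runs over all centres
  x.\<close>

lemma (in prob_space) small_ball_geometric:
  fixes \<xi> :: "'i \<Rightarrow> 'a \<Rightarrow> complex"
  assumes indep: "indep_vars (\<lambda>_. borel) \<xi> UNIV"
    and conc: "\<And>i y. measure (distr M borel (\<xi> i)) {z. cmod z > B \<or> cmod (z - y) \<le> r0} \<le> q"
    and B: "B \<ge> 0" and F: "finite F" and inj: "inj_on p {..<L}" and disj: "p ` {..<L} \<inter> F = {}"
    and coeff: "\<And>l. l < L \<Longrightarrow> cmod (c (p l)) = D * t ^ l"
    and D: "D > 0" and t: "t > 0" "(r0 + B) * t \<le> r0"
    and l: "l \<le> L"
  shows "prob {\<omega> \<in> space M. cmod ((\<Sum>i\<in>F \<union> p ` {..<l}. c i * \<xi> i \<omega>) - x) \<le> (r0 + B) * D * t ^ l} \<le> q ^ l"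
  using l
proof (induction l arbitrary: x)
  case 0
  then show ?case by simp
next
  case (Suc l)
  let ?X = "\<lambda>\<omega>. \<Sum>i\<in>F \<union> p ` {..<l}. c i * \<xi> i \<omega>"
  have new: "p l \<notin> F \<union> p ` {..<l}"
  proof -
    have "l \<in> {..<L}" "{..<l} \<subseteq> {..<L}" "l \<notin> {..<l}" using Suc.prems by auto
    then show ?thesis using inj_on_image_mem_iff[OF inj, of l "{..<l}"] disj by blast
  qed
  have c: "cmod (c (p l)) = D * t ^ l" using coeff Suc.prems by simp
  have "(\<Sum>i\<in>F \<union> p ` {..<Suc l}. c i * \<xi> i \<omega>) = ?X \<omega> + c (p l) * \<xi> (p l) \<omega>" for \<omega>
    using new F by (simp add: lessThan_Suc add.commute)
  moreover have "prob {\<omega> \<in> space M. cmod (?X \<omega> + c (p l) * \<xi> (p l) \<omega> - x) \<le> (r0 + B) * D * t ^ Suc l}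
      \<le> q ^ l * q"
  proof (rule small_ball_add)
    show "indep_var borel ?X borel (\<xi> (p l))"
      using new F by (intro indep_var_linear_combination indep) auto
    show "prob {\<omega> \<in> space M. cmod (?X \<omega> - x) \<le> (r0 + B) * D * t ^ l} \<le> q ^ l" for x
      using Suc by simp
    show "c (p l) \<noteq> 0" using c D t by auto
    have *: "(r0 + B) * D * t ^ Suc l = ((r0 + B) * t) * (D * t ^ l)" by simp
    also have "\<dots> \<le> r0 * (D * t ^ l)"
      using D t by (intro mult_right_mono) auto
    finally show 1: "(r0 + B) * D * t ^ Suc l \<le> r0 * cmod (c (p l))" by (simp add: c)
    have "(r0 + B) * D * t ^ l = r0 * (D * t ^ l) + B * (D * t ^ l)"
      by (simp add: algebra_simps)
    with 1 show "(r0 + B) * D * t ^ Suc l + B * cmod (c (p l)) \<le> (r0 + B) * D * t ^ l"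
      by (simp add: c)
  qed (use conc B in auto)
  ultimately show ?case by (simp add: mult.commute)
qed

text \<open>With |a - b| = 4 r0, every y is at distance at least 2 r0 from a or b. The open r0-ball
  about that point avoids the closed r0-ball about y and lies in |z| \<le> B, so mass at least m is
  missed.\<close>

lemma two_point_support_concentration:
  fixes N :: "complex measure"
  assumes "prob_space N" and [measurable_cong, simp]: "sets N = sets borel" and "a \<noteq> b"
    and a: "\<And>U. open U \<Longrightarrow> a \<in> U \<Longrightarrow> emeasure N U > 0"
    and b: "\<And>U. open U \<Longrightarrow> b \<in> U \<Longrightarrow> emeasure N U > 0"
  obtains r0 B q where "r0 > 0" "B \<ge> 1" "0 < q" "q < (1::real)"
    "\<And>y. measure N {z. cmod z > B \<or> cmod (z - y) \<le> r0} \<le> q"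
proof -
  interpret prob_space N by fact
  have [simp]: "space N = UNIV" using sets_eq_imp_space_eq[OF assms(2)] by simp
  define r0 where "r0 = cmod (a - b) / 4"
  have r0: "r0 > 0" using \<open>a \<noteq> b\<close> by (simp add: r0_def)
  define B where "B = max 1 (cmod a + cmod b + r0)"
  define m where "m = min (prob (ball a r0)) (prob (ball b r0))"
  have B: "cmod a + r0 \<le> B" "cmod b + r0 \<le> B"
    unfolding B_def by (simp_all add: max.coboundedI2)
  have m: "m > 0"
    using a[of "ball a r0"] b[of "ball b r0"] r0 by (simp add: m_def emeasure_eq_measure)
  have "prob {z. cmod z > B \<or> cmod (z - y) \<le> r0} \<le> 1 - m" for y
  proof -
    have *: "prob {z. cmod z > B \<or> cmod (z - y) \<le> r0} \<le> 1 - m"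
      if "cmod (e - y) \<ge> 2 * r0" "cmod e + r0 \<le> B" "m \<le> prob (ball e r0)" for e
    proof -
      have "\<not> (cmod z > B \<or> cmod (z - y) \<le> r0)" if "z \<in> ball e r0" for z
        using that \<open>cmod (e - y) \<ge> 2 * r0\<close> \<open>cmod e + r0 \<le> B\<close>
          norm_triangle_ineq[of e "z - e"] norm_triangle_ineq[of "e - z" "z - y"]
        by (auto simp: dist_norm norm_minus_commute)
      then have "{z. cmod z > B \<or> cmod (z - y) \<le> r0} \<subseteq> space N - ball e r0" by auto
      then have "prob {z. cmod z > B \<or> cmod (z - y) \<le> r0} \<le> prob (space N - ball e r0)"
        by (intro finite_measure_mono) auto
      also have "\<dots> = 1 - prob (ball e r0)" by (intro prob_compl) auto
      finally show ?thesis using that(3) by simp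
    qed
    have "cmod (a - b) \<le> cmod (a - y) + cmod (b - y)"
      using norm_triangle_ineq4[of "a - y" "b - y"] by simp
    then consider "cmod (a - y) \<ge> 2 * r0" | "cmod (b - y) \<ge> 2 * r0"
      unfolding r0_def by fastforce
    then show ?thesis
    proof cases
      case 1
      then show ?thesis by (rule *) (simp_all add: B m_def)
    next
      case 2
      then show ?thesis by (rule *) (simp_all add: B m_def)
    qed
  qed
  then show thesis
    \<comment> \<open>The maximum with 1/2 secures \<open>q > 0\<close> directly;
      \<open>B \<ge> 1\<close> later gives \<open>r0 + B \<ge> 1\<close>.\<close>
    using m r0 by (intro that[of r0 B "max (1 - m) (1/2)"]) (auto simp: B_def le_max_iff_disj)
qed

section \<open>Random coefficients\<close>

text \<open>Summing \<open>(k + 1) P(L > \<epsilon> k)\<close> over \<open>k\<close> costs a second moment of \<open>L\<close>; the factor \<open>k + 1\<close>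
  is the number of indices \<open>(i, j)\<close> with \<open>i + j = k\<close>.\<close>

lemma (in prob_space) summable_weighted_tail:
  assumes [measurable]: "L \<in> borel_measurable M" and int: "integrable M (\<lambda>\<omega>. (L \<omega>)\<^sup>2)" and e: "\<epsilon> > 0"
  shows "summable (\<lambda>k. real (k + 1) * prob {\<omega> \<in> space M. L \<omega> > \<epsilon> * real k})"
proof -
  let ?A = "\<lambda>k. {\<omega> \<in> space M. L \<omega> > \<epsilon> * real k}"
  have pt: "(\<Sum>k. ennreal (real (k + 1)) * indicator (?A k) \<omega>) \<le> ennreal (2 / \<epsilon>\<^sup>2 * (L \<omega>)\<^sup>2 + 2)"
    if "\<omega> \<in> space M" for \<omega>
  proof -
    \<comment> \<open>Only k < N contribute, each with weight at most N. The sum is therefore at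
      most N^2, which is where the square of L appears.\<close>
    define N where "N = nat \<lceil>L \<omega> / \<epsilon>\<rceil>"
    have N: "k < N" if "L \<omega> > \<epsilon> * real k" for k
    proof -
      have "real k < L \<omega> / \<epsilon>" using that e by (simp add: field_simps)
      then show ?thesis unfolding N_def by linarith
    qed
    have "(\<Sum>k. ennreal (real (k + 1)) * indicator (?A k) \<omega>) =
        (\<Sum>k\<in>{..<N}. ennreal (real (k + 1)) * indicator (?A k) \<omega>)"
      using N by (intro suminf_finite) (auto simp: indicator_def)
    also have "\<dots> \<le> (\<Sum>k\<in>{..<N}. ennreal (real N))"
    proof (intro sum_mono)
      fix k assume "k \<in> {..<N}"
      then have "ennreal (real (k + 1)) \<le> ennreal (real N)" by (intro ennreal_leI) simp
      then show "ennreal (real (k + 1)) * indicator (?A k) \<omega> \<le> ennreal (real N)"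
        by (cases "\<omega> \<in> ?A k") (simp_all only: indicator_simps mult_1_right mult_zero_right zero_le not_False_eq_True)
    qed
    also have "\<dots> = ennreal (real N * real N)"
      by (simp add: ennreal_of_nat_eq_real_of_nat ennreal_mult)
    also have "real N * real N \<le> 2 / \<epsilon>\<^sup>2 * (L \<omega>)\<^sup>2 + 2"
    proof (cases "L \<omega> / \<epsilon> > 0")
      case True
      then have "real N \<le> L \<omega> / \<epsilon> + 1" unfolding N_def by linarith
      then have "real N * real N \<le> (L \<omega> / \<epsilon> + 1) * (L \<omega> / \<epsilon> + 1)"
        using True by (intro mult_mono) auto
      also have "\<dots> \<le> 2 * (L \<omega> / \<epsilon>)\<^sup>2 + 2"
      proof -
        have "(y + 1) * (y + 1) \<le> 2 * y\<^sup>2 + 2" for y :: real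
          using zero_le_square[of "y - 1"] by (simp add: power2_eq_square algebra_simps)
        then show ?thesis .
      qed
      finally show ?thesis by (simp add: power_divide)
    next
      case False
      then have "N = 0" unfolding N_def by simp
      then show ?thesis by simp
    qed
    finally show ?thesis by (simp add: ennreal_leI)
  qed
  have "(\<Sum>k. ennreal (real (k + 1) * prob (?A k))) = (\<Sum>k. \<integral>\<^sup>+\<omega>. ennreal (real (k + 1)) * indicator (?A k) \<omega> \<partial>M)"
    by (intro suminf_cong) (simp add: nn_integral_cmult_indicator emeasure_eq_measure ennreal_mult)
  also have "\<dots> = (\<integral>\<^sup>+\<omega>. (\<Sum>k. ennreal (real (k + 1)) * indicator (?A k) \<omega>) \<partial>M)"
    by (intro nn_integral_suminf[symmetric]) measurable
  also have "\<dots> \<le> (\<integral>\<^sup>+\<omega>. ennreal (2 / \<epsilon>\<^sup>2 * (L \<omega>)\<^sup>2 + 2) \<partial>M)"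
    by (intro nn_integral_mono pt)
  also have "\<dots> < \<infinity>"
  proof -
    have "integrable M (\<lambda>\<omega>. 2 / \<epsilon>\<^sup>2 * (L \<omega>)\<^sup>2 + 2)" using int by simp
    then show ?thesis
      by (subst nn_integral_eq_integral) auto
  qed
  finally show ?thesis
    by (intro summable_suminf_not_top) auto
qed

text \<open>Borel-Cantelli is applied by degree: \<open>D k\<close> is the event that some
  coefficient on the antidiagonal i + j = k is too large, and a union bound over its k + 1 entries
  gives the weighted tail.\<close>

lemma (in prob_space) AE_subexponential:
  fixes \<xi> :: "nat \<times> nat \<Rightarrow> 'a \<Rightarrow> complex"
  assumes [measurable]: "\<And>p. \<xi> p \<in> borel_measurable M"
    and ident: "\<And>p q. distr M borel (\<xi> p) = distr M borel (\<xi> q)"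
    and int: "integrable M (\<lambda>\<omega>. (ln (1 + cmod (\<xi> (0, 0) \<omega>)))\<^sup>2)"
  shows "AE \<omega> in M. subexponential (\<lambda>p. \<xi> p \<omega>)"
proof -
  have ev: "AE \<omega> in M. eventually (\<lambda>k. \<forall>i j. i + j = k \<longrightarrow> cmod (\<xi> (i, j) \<omega>) \<le> exp (\<epsilon> * real k)) sequentially"
    if e: "\<epsilon> > 0" for \<epsilon>
  proof -
    let ?L = "\<lambda>\<omega>. ln (1 + cmod (\<xi> (0, 0) \<omega>))"
    define A where "A p k = {\<omega> \<in> space M. cmod (\<xi> p \<omega>) > exp (\<epsilon> * real k)}" for p k
    define D where "D k = (\<Union>i\<in>{..k}. A (i, k - i) k)" for k
    have [measurable]: "A p k \<in> events" "D k \<in> events" for p k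
      unfolding D_def A_def by measurable
    have A_le: "prob (A p k) \<le> prob {\<omega> \<in> space M. ?L \<omega> > \<epsilon> * real k}" for p k
    proof -
      have "prob (A p k) = measure (distr M borel (\<xi> p)) {z. cmod z > exp (\<epsilon> * real k)}" for p
        unfolding A_def by (subst measure_distr) (auto intro!: arg_cong[where f = prob])
      then have "prob (A p k) = prob (A (0, 0) k)" using ident[of p "(0, 0)"] by simp
      also have "\<dots> \<le> prob {\<omega> \<in> space M. ?L \<omega> > \<epsilon> * real k}"
      proof (intro finite_measure_mono subsetI)
        fix \<omega> assume "\<omega> \<in> A (0, 0) k"
        then have w: "\<omega> \<in> space M" and "exp (\<epsilon> * real k) < 1 + cmod (\<xi> (0, 0) \<omega>)"
          by (auto simp: A_def)
        then have "ln (exp (\<epsilon> * real k)) < ?L \<omega>"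
          by (subst ln_less_cancel_iff) (auto intro: add_pos_nonneg)
        with w show "\<omega> \<in> {\<omega> \<in> space M. ?L \<omega> > \<epsilon> * real k}" by simp
      qed measurable
      finally show ?thesis .
    qed
    have D_le: "prob (D k) \<le> real (k + 1) * prob {\<omega> \<in> space M. ?L \<omega> > \<epsilon> * real k}" for k
    proof -
      have "prob (D k) \<le> (\<Sum>i\<in>{..k}. prob (A (i, k - i) k))"
        unfolding D_def by (intro finite_measure_subadditive_finite) auto
      also have "\<dots> \<le> (\<Sum>i\<in>{..k}. prob {\<omega> \<in> space M. ?L \<omega> > \<epsilon> * real k})"
        by (intro sum_mono A_le)
      finally show ?thesis by simp
    qed
    have "summable (\<lambda>k. prob (D k))"
    proof (rule summable_comparison_test)
      show "\<exists>N. \<forall>k\<ge>N. norm (prob (D k)) \<le> real (k + 1) * prob {\<omega> \<in> space M. ?L \<omega> > \<epsilon> * real k}"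
        using D_le by auto
      show "summable (\<lambda>k. real (k + 1) * prob {\<omega> \<in> space M. ?L \<omega> > \<epsilon> * real k})"
        by (intro summable_weighted_tail int e) measurable
    qed
    then have "AE \<omega> in M. eventually (\<lambda>k. \<omega> \<in> space M - D k) sequentially"
      by (intro borel_cantelli_AE1) (auto simp: emeasure_eq_measure)
    then show ?thesis
    proof eventually_elim
      case (elim \<omega>)
      then show ?case
      proof eventually_elim
        case (elim k)
        show ?case
        proof (intro allI impI)
          fix i j assume "i + j = k"
          then have ij: "i \<le> k" "k - i = j" by auto
          from elim ij(1) have "cmod (\<xi> (i, k - i) \<omega>) \<le> exp (\<epsilon> * real k)"
            by (auto simp: D_def A_def not_less)
          then show "cmod (\<xi> (i, j) \<omega>) \<le> exp (\<epsilon> * real k)" by (simp only: ij)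
        qed
      qed
    qed
  qed
  have "AE \<omega> in M. \<forall>m::nat. eventually (\<lambda>k. \<forall>i j. i + j = k \<longrightarrow>
      cmod (\<xi> (i, j) \<omega>) \<le> exp (inverse (real (Suc m)) * real k)) sequentially"
    by (subst AE_all_countable) (intro allI ev, simp)
  then show ?thesis
  proof eventually_elim
    case (elim \<omega>)
    show ?case
      unfolding subexponential_def
    proof (intro allI impI)
      fix \<epsilon> :: real assume "\<epsilon> > 0"
      then obtain m where m: "inverse (real (Suc m)) < \<epsilon>" using reals_Archimedean by blast
      obtain K where K: "\<And>i j. i + j \<ge> K \<Longrightarrow>
          cmod (\<xi> (i, j) \<omega>) \<le> exp (inverse (real (Suc m)) * real (i + j))"
        using elim[rule_format, of m] unfolding eventually_sequentially by blast
      \<comment> \<open>The sum absorbs the finitely many entries before the threshold K; the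
        leading 1 serves all later ones.\<close>
      define C where "C = 1 + (\<Sum>p\<in>{(i, j). i + j \<le> K}. cmod (\<xi> p \<omega>))"
      have C1: "C \<ge> 1" unfolding C_def by (simp add: sum_nonneg)
      have "cmod (\<xi> (i, j) \<omega>) \<le> C * exp (\<epsilon> * real (i + j))" for i j
      proof (cases "i + j \<ge> K")
        case True
        have "inverse (real (Suc m)) * real (i + j) \<le> \<epsilon> * real (i + j)"
          using m by (intro mult_right_mono) auto
        then have "exp (inverse (real (Suc m)) * real (i + j)) \<le> 1 * exp (\<epsilon> * real (i + j))"
          by simp
        also have "\<dots> \<le> C * exp (\<epsilon> * real (i + j))" using C1 by (intro mult_right_mono) auto
        finally show ?thesis using K[OF True] by linarith
      next
        case False
        then have "cmod (\<xi> (i, j) \<omega>) \<le> (\<Sum>p\<in>{(i, j). i + j \<le> K}. cmod (\<xi> p \<omega>))"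
          by (intro member_le_sum finite_pairs_le) auto
        then have "cmod (\<xi> (i, j) \<omega>) \<le> C * 1" by (simp add: C_def)
        also have "\<dots> \<le> C * exp (\<epsilon> * real (i + j))"
          using C1 \<open>\<epsilon> > 0\<close> by (intro mult_left_mono) auto
        finally show ?thesis .
      qed
      then show "\<exists>C. \<forall>i j. cmod (\<xi> (i, j) \<omega>) \<le> C * exp (\<epsilon> * real (i + j))" by blast
    qed
  qed
qed

text \<open>If \<open>V x > 0\<close>, descend from \<open>z\<^sub>1\<^sup>n\<close> or \<open>z\<^sub>2\<^sup>n\<close>; if \<open>V x = 0\<close>, take the powers of \<open>z\<^sub>1\<^sup>m\<close>,
  which decay only for \<open>0 < \<bar>z\<^sub>1\<bar> < 1\<close>.\<close>

lemma geometric_monomials: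
  assumes z: "fst x \<noteq> 0" "cmod (fst x) \<noteq> 1" and k: "\<kappa> > (0::real)"
  obtains m t where "m > 0" "0 < t" "t \<le> \<kappa>"
    "\<And>n::nat. \<exists>p. inj_on p {..<n div m} \<and> p ` {..<n div m} \<subseteq> {(i, j). i + j \<le> n} \<and>
       (\<forall>l<n div m. cmod (fst x ^ fst (p l) * snd x ^ snd (p l)) = exp (n * V x) * t ^ l)"
proof -
  have power_small: "\<exists>m>0. s ^ m \<le> \<kappa>" if s: "0 < s" "s < 1" for s :: real
  proof -
    obtain m where "s ^ m < \<kappa>" using real_arch_pow_inv[OF k s(2)] by blast
    moreover have "s ^ Suc m \<le> s ^ m" using that by (intro power_decreasing) auto
    ultimately show ?thesis by (intro exI[of _ "Suc m"]) auto
  qed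
  \<comment> \<open>Keeps the truncated subtraction \<open>n - m * l\<close> genuine, so the
    descending exponents stay distinct.\<close>
  have idx: "m * l \<le> n" if "l < n div m" for l m n :: nat
  proof -
    have "m * l \<le> m * (n div m)" using that by (intro mult_left_mono) auto
    also have "\<dots> \<le> n" by simp
    finally show ?thesis .
  qed
  have powr: "r ^ (n - m * l) = r ^ n * (inverse (r ^ m)) ^ l" if "r > 0" "m * l \<le> n" for r :: real and m l n
  proof -
    have "r ^ n = r ^ (n - m * l) * (r ^ m) ^ l"
      using that by (simp flip: power_mult power_add)
    then show ?thesis using that by (simp add: power_inverse field_simps)
  qed
  let ?r = "exp (V x)"
  consider (zero) "V x = 0" | (fst) "V x > 0" "cmod (fst x) = ?r" | (snd) "V x > 0" "cmod (snd x) = ?r"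
  proof (cases "V x = 0")
    case False
    then have pos: "V x > 0" using V_nonneg[of x] by simp
    \<comment> \<open>A positive logarithm excludes a = 0, because \<open>ln 0 = 0\<close>.\<close>
    have exp_ln: "exp (ln (cmod a)) = cmod a" if "ln (cmod a) > 0" for a
      using that by (intro exp_ln) (auto simp: not_less less_le)
    have "V x = ln (cmod (fst x)) \<or> V x = ln (cmod (snd x))"
      using pos by (auto simp: V_def case_prod_unfold max_def split: if_splits)
    then show thesis using that pos exp_ln by metis
  qed (use that in auto)
  then show thesis
  proof cases
    case zero
    then have "cmod (fst x) \<le> 1" using cmod_le_exp_V(1)[of x] by simp
    then have s: "0 < cmod (fst x)" "cmod (fst x) < 1" using z by auto
    obtain m where m: "m > 0" "cmod (fst x) ^ m \<le> \<kappa>" using power_small[OF s] by blast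
    show thesis
    proof (rule that[OF m(1) _ m(2)])
      fix n
      show "\<exists>p. inj_on p {..<n div m} \<and> p ` {..<n div m} \<subseteq> {(i, j). i + j \<le> n} \<and>
        (\<forall>l<n div m. cmod (fst x ^ fst (p l) * snd x ^ snd (p l)) = exp (n * V x) * (cmod (fst x) ^ m) ^ l)"
        using m(1) idx zero
        by (intro exI[of _ "\<lambda>l. (m * l, 0)"]) (auto simp: inj_on_def norm_power power_mult)
    qed (use s in auto)
  next
    case fst
    obtain m where m: "m > 0" "inverse ?r ^ m \<le> \<kappa>"
      using power_small[of "inverse ?r"] fst(1) by (auto simp: inverse_less_1_iff)
    show thesis
    proof (rule that[OF m(1)])
      show "0 < inverse (?r ^ m)" "inverse (?r ^ m) \<le> \<kappa>" using m(2) by (simp_all add: power_inverse)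
      fix n
      show "\<exists>p. inj_on p {..<n div m} \<and> p ` {..<n div m} \<subseteq> {(i, j). i + j \<le> n} \<and>
        (\<forall>l<n div m. cmod (fst x ^ fst (p l) * snd x ^ snd (p l)) = exp (n * V x) * inverse (?r ^ m) ^ l)"
      proof (intro exI[of _ "\<lambda>l. (n - m * l, 0)"] conjI allI impI)
        show "inj_on (\<lambda>l. (n - m * l, 0)) {..<n div m}"
        proof (rule inj_onI)
          fix l l' assume "l \<in> {..<n div m}" "l' \<in> {..<n div m}" "(n - m * l, 0) = (n - m * l', 0)"
          then have "n - m * l = n - m * l'" "m * l \<le> n" "m * l' \<le> n"
            by (simp_all add: idx)
          then have "m * l = m * l'" by linarith
          then show "l = l'" using m(1) by simp
        qed
        fix l assume "l < n div m"
        then show "cmod (fst x ^ fst (n - m * l, 0) * snd x ^ snd (n - m * l, 0)) = exp (n * V x) * inverse (?r ^ m) ^ l"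
          using powr[of ?r m l n] idx by (simp add: norm_power fst(2) exp_of_nat_mult)
      qed auto
    qed
  next
    case snd
    obtain m where m: "m > 0" "inverse ?r ^ m \<le> \<kappa>"
      using power_small[of "inverse ?r"] snd(1) by (auto simp: inverse_less_1_iff)
    show thesis
    proof (rule that[OF m(1)])
      show "0 < inverse (?r ^ m)" "inverse (?r ^ m) \<le> \<kappa>" using m(2) by (simp_all add: power_inverse)
      fix n
      show "\<exists>p. inj_on p {..<n div m} \<and> p ` {..<n div m} \<subseteq> {(i, j). i + j \<le> n} \<and>
        (\<forall>l<n div m. cmod (fst x ^ fst (p l) * snd x ^ snd (p l)) = exp (n * V x) * inverse (?r ^ m) ^ l)"
      proof (intro exI[of _ "\<lambda>l. (0, n - m * l)"] conjI allI impI)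
        show "inj_on (\<lambda>l. (0, n - m * l)) {..<n div m}"
        proof (rule inj_onI)
          fix l l' assume "l \<in> {..<n div m}" "l' \<in> {..<n div m}" "(0, n - m * l) = (0, n - m * l')"
          then have "n - m * l = n - m * l'" "m * l \<le> n" "m * l' \<le> n"
            by (simp_all add: idx)
          then have "m * l = m * l'" by linarith
          then show "l = l'" using m(1) by simp
        qed
        fix l assume "l < n div m"
        then show "cmod (fst x ^ fst (0, n - m * l) * snd x ^ snd (0, n - m * l)) = exp (n * V x) * inverse (?r ^ m) ^ l"
          using powr[of ?r m l n] idx by (simp add: norm_power snd(2) exp_of_nat_mult)
      qed auto
    qed
  qed
qed

text \<open>With s the N-th root of q, n \<le> N (n div N + 1) gives q^(n div N) \<le> s^n /
  q.\<close>

lemma summable_power_div: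
  fixes q :: real
  assumes "0 < q" "q < 1" "N > 0"
  shows "summable (\<lambda>n. q ^ (n div N))"
proof (rule summable_comparison_test)
  define s where "s = root N q"
  have s: "0 < s" "s < 1" "s ^ N = q" using assms by (simp_all add: s_def)
  have "q ^ (n div N) \<le> inverse q * s ^ n" for n
  proof -
    have "n \<le> N * Suc (n div N)"
      using assms(3) by (simp add: less_imp_le dividend_less_times_div)
    then have "s ^ (N * Suc (n div N)) \<le> s ^ n" using s by (intro power_decreasing) auto
    then have "q ^ Suc (n div N) \<le> s ^ n" by (simp only: power_mult s)
    then show ?thesis using assms(1) by (simp add: field_simps)
  qed
  then show "\<exists>M. \<forall>n\<ge>M. norm (q ^ (n div N)) \<le> inverse q * s ^ n"
    using assms(1) by auto
  show "summable (\<lambda>n. inverse q * s ^ n)"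
    using s by (intro summable_mult summable_geometric) auto
qed

lemma (in prob_space) AE_lower_bound:
  fixes \<xi> :: "nat \<times> nat \<Rightarrow> 'a \<Rightarrow> complex"
  assumes indep: "indep_vars (\<lambda>_. borel) \<xi> UNIV"
    and conc: "\<And>i y. measure (distr M borel (\<xi> i)) {z. cmod z > B \<or> cmod (z - y) \<le> r0} \<le> q"
    and r0: "r0 > 0" and B: "B \<ge> 1" and q: "0 < q" "q < 1"
    and x: "fst x \<noteq> 0" "cmod (fst x) \<noteq> 1" and e: "\<epsilon> > 0"
  shows "AE \<omega> in M. eventually (\<lambda>n. cmod (Kpoly (\<lambda>p. \<xi> p \<omega>) n x) \<ge> exp (n * (V x - \<epsilon>))) sequentially"
proof -
  have [measurable]: "\<xi> p \<in> borel_measurable M" for p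
    using indep unfolding indep_vars_def by blast
  have K_meas [measurable]: "(\<lambda>\<omega>. Kpoly (\<lambda>p. \<xi> p \<omega>) n x) \<in> borel_measurable M" for n
    unfolding Kpoly_eq by measurable
  obtain m t where m: "m > 0" and t: "0 < t" "t \<le> r0 / (r0 + B)" and geo:
    "\<And>n::nat. \<exists>p. inj_on p {..<n div m} \<and> p ` {..<n div m} \<subseteq> {(i, j). i + j \<le> n} \<and>
       (\<forall>l<n div m. cmod (fst x ^ fst (p l) * snd x ^ snd (p l)) = exp (n * V x) * t ^ l)"
  proof (rule geometric_monomials[OF x, of "r0 / (r0 + B)"])
    show "r0 / (r0 + B) > 0" using r0 B by simp
  qed (rule that)
  have tB: "(r0 + B) * t \<le> r0"
    using t(2) r0 B by (simp add: pos_le_divide_eq mult.commute)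
  \<comment> \<open>Only \<open>n div N\<close> monomials are used: N \<ge> m makes them available,
    and N \<ge> ln(1/t)/\<epsilon> keeps the last scale t^(n div N) above exp(-n \<epsilon>). Their
    number still grows linearly in n.\<close>
  define N where "N = max m (nat \<lceil>ln (1 / t) / \<epsilon>\<rceil>)"
  have N: "N \<ge> m" "N > 0" "ln (1 / t) \<le> real N * \<epsilon>"
  proof -
    show "N \<ge> m" "N > 0" using m by (auto simp: N_def)
    have "ln (1 / t) / \<epsilon> \<le> real N" unfolding N_def by linarith
    then show "ln (1 / t) \<le> real N * \<epsilon>" using e by (simp add: field_simps)
  qed
  have t_ge: "exp (- (n * \<epsilon>)) \<le> t ^ (n div N)" for n :: nat
  proof -
    have "real (n div N) * ln (1 / t) \<le> real (n div N) * (real N * \<epsilon>)"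
      using N(3) by (intro mult_left_mono) auto
    also have "\<dots> = real (n div N * N) * \<epsilon>" by simp
    also have "\<dots> \<le> n * \<epsilon>" using e by (intro mult_right_mono) (auto simp del: of_nat_mult)
    finally have "- (n * \<epsilon>) \<le> real (n div N) * ln t" using t(1) by (simp add: ln_div)
    then have "exp (- (n * \<epsilon>)) \<le> exp (real (n div N) * ln t)" by simp
    also have "\<dots> = t ^ (n div N)" using t(1) by (simp add: exp_of_nat_mult)
    finally show ?thesis .
  qed
  define A where "A n = {\<omega> \<in> space M. cmod (Kpoly (\<lambda>p. \<xi> p \<omega>) n x) < exp (n * (V x - \<epsilon>))}" for n
  have A_meas [measurable]: "A n \<in> events" for n unfolding A_def by measurable
  have A_le: "prob (A n) \<le> q ^ (n div N)" for n
  proof -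
    let ?L = "n div N" and ?S = "{(i, j). i + j \<le> n}"
    let ?c = "\<lambda>i. fst x ^ fst i * snd x ^ snd i"
    obtain p where p: "inj_on p {..<n div m}" "p ` {..<n div m} \<subseteq> ?S"
      "\<And>l. l < n div m \<Longrightarrow> cmod (?c (p l)) = exp (n * V x) * t ^ l"
      using geo[of n] by blast
    have L: "?L \<le> n div m" using N(1) m by (intro div_le_mono2)
    then have sub: "{..<?L} \<subseteq> {..<n div m}" by auto
    have "p ` {..<?L} \<subseteq> ?S" by (rule order_trans[OF image_mono[OF sub] p(2)])
    \<comment> \<open>All remaining monomials become the set \<open>F\<close> of the small ball
      estimate.\<close>
    then have S: "(?S - p ` {..<?L}) \<union> p ` {..<?L} = ?S"
      by (simp only: Un_Diff_cancel2 Un_absorb2)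
    have "prob {\<omega> \<in> space M. cmod ((\<Sum>i\<in>(?S - p ` {..<?L}) \<union> p ` {..<?L}. ?c i * \<xi> i \<omega>) - 0)
        \<le> (r0 + B) * exp (n * V x) * t ^ ?L} \<le> q ^ ?L"
    proof (rule small_ball_geometric[OF indep conc])
      show "inj_on p {..<?L}" using p(1) sub by (rule inj_on_subset)
      show "cmod (?c (p l)) = exp (n * V x) * t ^ l" if "l < ?L" for l
        using p(3) that L by simp
    qed (use B t tB finite_pairs_le in auto)
    then have 1: "prob {\<omega> \<in> space M. cmod (Kpoly (\<lambda>p. \<xi> p \<omega>) n x) \<le> (r0 + B) * exp (n * V x) * t ^ ?L} \<le> q ^ ?L"
      unfolding S by (simp add: Kpoly_eq mult.commute)
    have "exp (n * (V x - \<epsilon>)) = exp (n * V x) * exp (- (n * \<epsilon>))"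
      by (simp add: algebra_simps flip: exp_add)
    also have "\<dots> \<le> exp (n * V x) * t ^ ?L"
      using t_ge by (intro mult_left_mono) auto
    also have "\<dots> \<le> (r0 + B) * (exp (n * V x) * t ^ ?L)"
    proof -
      have "1 * (exp (n * V x) * t ^ ?L) \<le> (r0 + B) * (exp (n * V x) * t ^ ?L)"
        using r0 B t by (intro mult_right_mono) auto
      then show ?thesis by simp
    qed
    finally have "prob (A n) \<le> prob {\<omega> \<in> space M. cmod (Kpoly (\<lambda>p. \<xi> p \<omega>) n x) \<le> (r0 + B) * exp (n * V x) * t ^ ?L}"
      unfolding A_def by (intro finite_measure_mono) (auto simp: mult.assoc)
    with 1 show ?thesis by linarith
  qed
  have "summable (\<lambda>n. prob (A n))"
  proof (rule summable_comparison_test)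
    show "\<exists>M. \<forall>n\<ge>M. norm (prob (A n)) \<le> q ^ (n div N)" using A_le by auto
    show "summable (\<lambda>n. q ^ (n div N))" by (rule summable_power_div[OF q N(2)])
  qed
  then have "AE \<omega> in M. eventually (\<lambda>n. \<omega> \<in> space M - A n) sequentially"
    by (intro borel_cantelli_AE1 A_meas) (auto simp: emeasure_eq_measure)
  then show ?thesis
    by eventually_elim (auto simp: A_def not_less elim: eventually_mono)
qed

section \<open>Exchanging points and outcomes\<close>

text \<open>Countably many values of \<epsilon> suffice by monotonicity. This allows intersecting
  null sets and proving joint measurability.\<close>

lemma lower_regular_iff:
  "lower_regular c x \<longleftrightarrow>
    (\<forall>k. eventually (\<lambda>n. cmod (Kpoly c n x) \<ge> exp (n * (V x - inverse (real (Suc k))))) sequentially)"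
proof
  assume R: "\<forall>k. eventually (\<lambda>n. cmod (Kpoly c n x) \<ge> exp (n * (V x - inverse (real (Suc k))))) sequentially"
  show "lower_regular c x"
    unfolding lower_regular_def
  proof (intro allI impI)
    fix \<epsilon> :: real assume "\<epsilon> > 0"
    then obtain k where k: "inverse (real (Suc k)) < \<epsilon>" using reals_Archimedean by blast
    from R[rule_format, of k] show "eventually (\<lambda>n. cmod (Kpoly c n x) \<ge> exp (n * (V x - \<epsilon>))) sequentially"
    proof eventually_elim
      case (elim n)
      have "exp (n * (V x - \<epsilon>)) \<le> exp (n * (V x - inverse (real (Suc k))))"
        unfolding exp_le_cancel_iff using k by (intro mult_left_mono) auto
      with elim show ?case by linarith
    qed
  qed
qed (auto simp: lower_regular_def)

lemma AE_lborel_fst_generic: "AE x :: C2 in lborel. fst x \<noteq> 0 \<and> cmod (fst x) \<noteq> 1"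
proof -
  have "sphere (0::complex) 1 \<in> null_sets lborel"
    using negligible_sphere[of "0::complex" 1]
    by (simp add: negligible_iff_null_sets null_sets_completion_iff)
  moreover have "{0::complex} \<in> null_sets lborel"
    by (intro finite_imp_null_set_lborel) simp
  ultimately have "AE z :: complex in lborel. z \<notin> sphere 0 1 \<and> z \<notin> {0}"
    by (simp only: AE_conj_iff AE_not_in)
  then have "AE z :: complex in lborel. AE w :: complex in lborel. fst (z, w) \<noteq> 0 \<and> cmod (fst (z, w)) \<noteq> 1"
    by eventually_elim simp
  moreover have "Measurable.pred (lborel :: complex measure) (\<lambda>z. z \<noteq> 0 \<and> cmod z \<noteq> 1)"
    by measurable
  from measurable_compose[OF measurable_fst this]
  have "{x \<in> space ((lborel :: complex measure) \<Otimes>\<^sub>M (lborel :: complex measure)). fst x \<noteq> 0 \<and> cmod (fst x) \<noteq> 1}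
      \<in> sets (lborel \<Otimes>\<^sub>M lborel)"
    by (simp only: pred_def)
  ultimately have "AE x in (lborel :: complex measure) \<Otimes>\<^sub>M (lborel :: complex measure). fst x \<noteq> 0 \<and> cmod (fst x) \<noteq> 1"
    by (rule lborel_pair.AE_pair_measure[rotated])
  then show ?thesis by (simp only: lborel_prod)
qed

text \<open>The null set of outcomes in \<open>AE_lower_bound\<close> depends on x. Joint
  measurability of the regular pairs lets Fubini turn this into one null set of outcomes, outside
  which almost every x is regular.\<close>

lemma (in prob_space) AE_lower_regular:
  fixes \<xi> :: "nat \<times> nat \<Rightarrow> 'a \<Rightarrow> complex"
  assumes indep: "indep_vars (\<lambda>_. borel) \<xi> UNIV"
    and conc: "\<And>i y. measure (distr M borel (\<xi> i)) {z. cmod z > B \<or> cmod (z - y) \<le> r0} \<le> q"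
    and r0: "r0 > 0" and B: "B \<ge> 1" and q: "0 < q" "q < 1"
  shows "AE \<omega> in M. AE x in lborel. lower_regular (\<lambda>p. \<xi> p \<omega>) x"
proof -
  have [measurable]: "\<xi> p \<in> borel_measurable M" for p
    using indep unfolding indep_vars_def by blast
  interpret P: pair_sigma_finite "lborel :: C2 measure" M ..
  have "AE x in lborel. AE \<omega> in M. lower_regular (\<lambda>p. \<xi> p \<omega>) x"
    using AE_lborel_fst_generic
  proof eventually_elim
    case (elim x)
    show ?case
      unfolding lower_regular_iff AE_all_countable
      using elim by (intro allI AE_lower_bound[OF indep conc r0 B q]) auto
  qed
  moreover have "{y \<in> space (lborel \<Otimes>\<^sub>M M). lower_regular (\<lambda>p. \<xi> p (snd y)) (fst y)} \<in> sets (lborel \<Otimes>\<^sub>M M)"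
  proof -
    have [measurable]: "(\<lambda>y. fst (fst y)) \<in> borel_measurable (lborel \<Otimes>\<^sub>M M)"
      "(\<lambda>y. snd (fst y)) \<in> borel_measurable (lborel \<Otimes>\<^sub>M M)"
      by (auto intro!: measurable_compose[OF measurable_fst] simp flip: borel_prod)
    have [measurable]: "(\<lambda>y. Kpoly (\<lambda>p. \<xi> p (snd y)) n (fst y)) \<in> borel_measurable (lborel \<Otimes>\<^sub>M M)" for n
      unfolding Kpoly_eq by measurable
    show ?thesis
      unfolding lower_regular_iff eventually_sequentially by measurable
  qed
  ultimately show ?thesis
    by (subst P.AE_commute[symmetric])
qed

theorem theorem7p7:
  fixes M :: "'a measure" and \<xi> :: "nat \<times> nat \<Rightarrow> 'a \<Rightarrow> complex"
  assumes "prob_space M"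
    and "prob_space.indep_vars M (\<lambda>_. borel) \<xi> UNIV"
    and "\<And>p q. distr M borel (\<xi> p) = distr M borel (\<xi> q)"
    and "\<And>p. nondegenerate M (\<xi> p)"
    and "integrable M (\<lambda>\<omega>. (ln (1 + cmod (\<xi> (0, 0) \<omega>)))\<^sup>2)"
  shows "AE \<omega> in M. current_tendsto (Z_current (\<lambda>p. \<xi> p \<omega>)) (ddc_current V)"
proof -
  interpret prob_space M by fact
  have meas [measurable]: "\<xi> p \<in> borel_measurable M" for p
    using assms(2) unfolding indep_vars_def by blast
  obtain a b where ab: "a \<noteq> b" "a \<in> law_support M (\<xi> (0, 0))" "b \<in> law_support M (\<xi> (0, 0))"
    using assms(4)[of "(0, 0)"] unfolding nondegenerate_def by blast
  obtain r0 B q where conc: "r0 > 0" "B \<ge> 1" "0 < q" "q < (1::real)"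
    "\<And>y. measure (distr M borel (\<xi> (0, 0))) {z. cmod z > B \<or> cmod (z - y) \<le> r0} \<le> q"
    by (rule two_point_support_concentration[of "distr M borel (\<xi> (0, 0))" a b])
       (use ab in \<open>auto simp: law_support_def intro!: prob_space_distr\<close>)
  \<comment> \<open>The constants were found for one law and serve every index by identical
    distribution.\<close>
  have "measure (distr M borel (\<xi> i)) {z. cmod z > B \<or> cmod (z - y) \<le> r0} \<le> q" for i y
    using conc(5) assms(3)[of i "(0, 0)"] by simp
  then have "AE \<omega> in M. AE x in lborel. lower_regular (\<lambda>p. \<xi> p \<omega>) x"
    by (rule AE_lower_regular[OF assms(2) _ conc(1-4)])
  moreover have "AE \<omega> in M. subexponential (\<lambda>p. \<xi> p \<omega>)"
    by (rule AE_subexponential[where \<xi> = \<xi>, OF meas assms(3,5)])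
  ultimately show ?thesis
    by eventually_elim (rule current_tendsto_of_regular)
qed

end
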